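(* Let $A:=\{n^2\mid n\in\mathbb{N}\}\subset\mathbb{Z}$, and consider $\mathbb{Z}\setminus A$ with the metric induced from (the standard metric on) $\mathbb{Z}$. Then the inclusion $i\colon\mathbb{Z}\setminus A\to\mathbb{Z}$ is a quasi-isometry inducing for all $k\in\mathbb{N}$ an isometric isomorphism $H^{\mathrm{uf}}_k(i;\mathbb{R})\colon H^{\mathrm{uf}}_k(\mathbb{Z}\setminus A;\mathbb{R})\to H^{\mathrm{uf}}_k(\mathbb{Z};\mathbb{R})$ with respect to the $\ell^\infty$-semi-norms, but $i$ is not uniformly close to a bilipschitz equivalence.
   Context: $\mathbb{N}=\{0,1,2,\dots\}$. A metric space $X$ is a UDBG space if (i) there is $\varepsilon>0$ such that for all $x,y\in X$: $d(x,y)<\varepsilon$ if and only if $x=y$; and (ii) for every $r>0$ there is $K>0$ with $|B_r(x)|<K$ for all $x\in X$. Maps between UDBG spaces: $f\colon X\to Y$ is a quasi-isometric embedding if there are $C,D>0$ with $\frac1C d_X(x,x')-D\le d_Y(f(x),f(x'))\le C d_X(x,x')+D$ for all $x,x'\in X$. Maps $f,f'\colon X\to Y$ are uniformly close if $\sup_{x\in X}d_Y(f(x),f'(x))<\infty$. A quasi-isometry is a quasi-isometric embedding $f$ for which there is a quasi-isometric embedding $g\colon Y\to X$ with $f\circ g$ uniformly close to $\mathrm{id}_Y$ and $g\circ f$ uniformly close to $\mathrm{id}_X$. A bilipschitz embedding is a map $f$ for which there is $C>0$ with $\frac1C d_X(x,x')\le d_Y(f(x),f(x'))\le C d_X(x,x')$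 for all $x,x'$; a bilipschitz equivalence is a bilipschitz embedding having a two-sided inverse that is a bilipschitz embedding. Uniformly finite homology: let $R=\mathbb{R}$ with the standard absolute value $|\cdot|$. For a UDBG space $X$ and $n\in\mathbb{N}$, $C^{\mathrm{uf}}_n(X;R)$ is the $R$-module of functions $X^{n+1}\to R$, written as formal sums $c=\sum_{x\in X^{n+1}}c_x\cdot x$, such that $\sup_x|c_x|<\infty$ and there is a constant $\rho>0$ (depending on $c$) with $c_x=0$ whenever $x=(x_0,\dots,x_n)$ satisfies $\sup_{i,j}d(x_i,x_j)>\rho$. The boundary operator $\partial_n\colon C^{\mathrm{uf}}_n(X;R)\to C^{\mathrm{uf}}_{n-1}(X;R)$ is the extension to such (possibly infinite) sums of $(x_0,\dots,x_n)\mapsto\sum_{j=0}^n(-1)^j(x_0,\dots,\widehat{x_j},\dots,x_n)$ (and every $0$-chain is a cycle). $H^{\mathrm{uf}}_*(X;R)$ is the homology of this chain complex. A quasi-isometric embedding $f\colon X\to Y$ induces the chain map $\sum_x c_x\cdot x\mapsto\sum_x c_x\cdot(f(x_0),\dots,f(x_n))$ and hence maps $H^{\mathrm{uf}}_n(f;R)\colon H^{\mathrm{uf}}_n(X;R)\to H^{\mathrm{uf}}_n(Y;R)$. The $\ell^\infty$-norm on chains is $\|\sum_x c_x\cdot x\|_\infty=\sup_x|c_x|$, and the $\ell^\infty$-semi-norm of $\alpha\in H^{\mathrm{uf}}_n(X;R)$ is $\|\alpha\|_\infty=\inf\{\|c\|_\infty : c\in C^{\mathrm{uf}}_n(X;R),\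 \partial c=0,\ [c]=\alpha\}$. An isometric isomorphism is an $R$-linear isomorphism preserving the semi-norms. *)

theory Defs
  imports "HOL-Analysis.Analysis" "HOL-Algebra.Module"
begin

section \<open>UDBG spaces and maps between them\<close>

definition UDBG :: "'a metric \<Rightarrow> bool" where
  "UDBG X \<longleftrightarrow>
     (\<exists>\<epsilon>>0. \<forall>x\<in>mspace X. \<forall>y\<in>mspace X. mdist X x y < \<epsilon> \<longleftrightarrow> x = y) \<and>
     (\<forall>r>0. \<exists>K::real. K > 0 \<and>
        (\<forall>x\<in>mspace X. finite (mball_of X x r) \<and> real (card (mball_of X x r)) < K))"

definition quasi_isometric_embedding :: "'a metric \<Rightarrow> 'b metric \<Rightarrow> ('a \<Rightarrow> 'b) \<Rightarrow> bool" where
  "quasi_isometric_embedding X Y f \<longleftrightarrow>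
     f \<in> mspace X \<rightarrow> mspace Y \<and>
     (\<exists>C>0. \<exists>D>0. \<forall>x\<in>mspace X. \<forall>x'\<in>mspace X.
        1 / C * mdist X x x' - D \<le> mdist Y (f x) (f x') \<and>
        mdist Y (f x) (f x') \<le> C * mdist X x x' + D)"

definition uniformly_close :: "'a metric \<Rightarrow> 'b metric \<Rightarrow> ('a \<Rightarrow> 'b) \<Rightarrow> ('a \<Rightarrow> 'b) \<Rightarrow> bool" where
  "uniformly_close X Y f f' \<longleftrightarrow> bdd_above ((\<lambda>x. mdist Y (f x) (f' x)) ` mspace X)"

definition quasi_isometry :: "'a metric \<Rightarrow> 'b metric \<Rightarrow> ('a \<Rightarrow> 'b) \<Rightarrow> bool" where
  "quasi_isometry X Y f \<longleftrightarrow>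
     quasi_isometric_embedding X Y f \<and>
     (\<exists>g. quasi_isometric_embedding Y X g \<and>
          uniformly_close Y Y (f \<circ> g) id \<and> uniformly_close X X (g \<circ> f) id)"

definition bilipschitz_embedding :: "'a metric \<Rightarrow> 'b metric \<Rightarrow> ('a \<Rightarrow> 'b) \<Rightarrow> bool" where
  "bilipschitz_embedding X Y f \<longleftrightarrow>
     f \<in> mspace X \<rightarrow> mspace Y \<and>
     (\<exists>C>0. \<forall>x\<in>mspace X. \<forall>x'\<in>mspace X.
        1 / C * mdist X x x' \<le> mdist Y (f x) (f x') \<and>
        mdist Y (f x) (f x') \<le> C * mdist X x x')"

definition bilipschitz_equivalence :: "'a metric \<Rightarrow> 'b metric \<Rightarrow> ('a \<Rightarrow> 'b) \<Rightarrow> bool" where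
  "bilipschitz_equivalence X Y f \<longleftrightarrow>
     bilipschitz_embedding X Y f \<and>
     (\<exists>g. bilipschitz_embedding Y X g \<and>
          (\<forall>x\<in>mspace X. g (f x) = x) \<and> (\<forall>y\<in>mspace Y. f (g y) = y))"

definition int_metric :: "int metric" where
  "int_metric = metric (UNIV, \<lambda>x y. real_of_int \<bar>x - y\<bar>)"


section \<open>Uniformly finite chains\<close>

text \<open>A tuple \<open>(x\<^sub>0, \<dots>, x\<^sub>n)\<close> is a list of length \<open>Suc n\<close>.  A formal sum over such tuples is a
  function on all lists that vanishes off \<open>uf_tuples n X\<close>.\<close>

definition uf_tuples :: "nat \<Rightarrow> 'a metric \<Rightarrow> 'a list set" where
  "uf_tuples n X = {x. length x = Suc n \<and> set x \<subseteq> mspace X}"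

definition uf_chains :: "nat \<Rightarrow> 'a metric \<Rightarrow> ('a list \<Rightarrow> real) set" where
  "uf_chains n X =
     {c. (\<forall>x. x \<notin> uf_tuples n X \<longrightarrow> c x = 0) \<and>
         bdd_above (range (\<lambda>x. \<bar>c x\<bar>)) \<and>
         (\<exists>\<rho>>0. \<forall>x\<in>uf_tuples n X.
            (MAX (p, q)\<in>set x \<times> set x. mdist X p q) > \<rho> \<longrightarrow> c x = 0)}"

text \<open>The extension of a map \<open>g\<close> of tuples to formal sums, \<open>\<Sum>\<^sub>x c\<^sub>x \<cdot> x \<mapsto> \<Sum>\<^sub>x c\<^sub>x \<cdot> g x\<close>: the coefficient
  at \<open>y\<close> collects the nonzero \<open>c\<^sub>x\<close> with \<open>g x = y\<close>.  In the uses below only finitely many occur, see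
  \<open>finite_face_fibre\<close> and \<open>finite_map_fibre\<close>.\<close>

definition extend_to_sums :: "('a list \<Rightarrow> 'b list) \<Rightarrow> ('a list \<Rightarrow> real) \<Rightarrow> 'b list \<Rightarrow> real" where
  "extend_to_sums g c y = (\<Sum>x | c x \<noteq> 0 \<and> g x = y. c x)"

definition face :: "nat \<Rightarrow> 'a list \<Rightarrow> 'a list" where
  "face j x = take j x @ drop (Suc j) x"

definition uf_boundary :: "nat \<Rightarrow> ('a list \<Rightarrow> real) \<Rightarrow> 'a list \<Rightarrow> real" where
  "uf_boundary n c =
     (if n = 0 then (\<lambda>_. 0) else (\<lambda>y. \<Sum>j\<le>n. (-1) ^ j * extend_to_sums (face j) c y))"

text \<open>Off the tuples chains vanish, so the supremum may run over all lists.\<close>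

definition uf_norm :: "('a list \<Rightarrow> real) \<Rightarrow> real" where
  "uf_norm c = (SUP x. \<bar>c x\<bar>)"


section \<open>Uniformly finite homology\<close>

definition uf_cycles :: "nat \<Rightarrow> 'a metric \<Rightarrow> ('a list \<Rightarrow> real) set" where
  "uf_cycles n X = {c \<in> uf_chains n X. uf_boundary n c = (\<lambda>_. 0)}"

definition uf_boundaries :: "nat \<Rightarrow> 'a metric \<Rightarrow> ('a list \<Rightarrow> real) set" where
  "uf_boundaries n X = uf_boundary (Suc n) ` uf_chains (Suc n) X"

definition homologous :: "nat \<Rightarrow> 'a metric \<Rightarrow> (('a list \<Rightarrow> real) \<times> ('a list \<Rightarrow> real)) set" where
  "homologous n X =
     {(c, c') \<in> uf_cycles n X \<times> uf_cycles n X. (\<lambda>x. c x - c' x) \<in> uf_boundaries n X}"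

definition uf_class :: "nat \<Rightarrow> 'a metric \<Rightarrow> ('a list \<Rightarrow> real) \<Rightarrow> ('a list \<Rightarrow> real) set" where
  "uf_class n X c = homologous n X `` {c}"

text \<open>The multiplicative fields of the record are not part of the module structure.\<close>

definition uf_homology :: "nat \<Rightarrow> 'a metric \<Rightarrow> (real, ('a list \<Rightarrow> real) set) module" where
  "uf_homology n X =
     \<lparr>carrier = uf_cycles n X // homologous n X,
      monoid.mult = undefined,
      one = undefined,
      zero = uf_class n X (\<lambda>_. 0),
      add = (\<lambda>\<alpha> \<beta>. \<Union>c\<in>\<alpha>. \<Union>d\<in>\<beta>. uf_class n X (\<lambda>x. c x + d x)),
      smult = (\<lambda>r \<alpha>. \<Union>c\<in>\<alpha>. uf_class n X (\<lambda>x. r * c x))\<rparr>"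

definition uf_seminorm :: "nat \<Rightarrow> 'a metric \<Rightarrow> ('a list \<Rightarrow> real) set \<Rightarrow> real" where
  "uf_seminorm n X \<alpha> =
     Inf {uf_norm c | c. c \<in> uf_chains n X \<and> uf_boundary n c = (\<lambda>_. 0) \<and> uf_class n X c = \<alpha>}"

definition uf_induced ::
    "nat \<Rightarrow> 'b metric \<Rightarrow> ('a \<Rightarrow> 'b) \<Rightarrow> ('a list \<Rightarrow> real) set \<Rightarrow> ('b list \<Rightarrow> real) set" where
  "uf_induced n Y f \<alpha> = (\<Union>c\<in>\<alpha>. uf_class n Y (extend_to_sums (map f) c))"

definition linear_isomorphisms :: "(real, 'a) module \<Rightarrow> (real, 'b) module \<Rightarrow> ('a \<Rightarrow> 'b) set" where
  "linear_isomorphisms M N =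
     {F \<in> iso (add_monoid M) (add_monoid N).
        \<forall>r. \<forall>\<alpha>\<in>carrier M. F (r \<odot>\<^bsub>M\<^esub> \<alpha>) = r \<odot>\<^bsub>N\<^esub> F \<alpha>}"

definition uf_isometric_isomorphism ::
    "nat \<Rightarrow> 'a metric \<Rightarrow> 'b metric \<Rightarrow> (('a list \<Rightarrow> real) set \<Rightarrow> ('b list \<Rightarrow> real) set) \<Rightarrow> bool" where
  "uf_isometric_isomorphism n X Y F \<longleftrightarrow>
     F \<in> linear_isomorphisms (uf_homology n X) (uf_homology n Y) \<and>
     (\<forall>\<alpha>\<in>carrier (uf_homology n X). uf_seminorm n Y (F \<alpha>) = uf_seminorm n X \<alpha>)"


section \<open>Well-definedness\<close>

lemma Metric_space_int: "Metric_space UNIV (\<lambda>x y. real_of_int \<bar>x - y\<bar>)"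
  by unfold_locales auto

lemma mspace_int_metric [simp]: "mspace int_metric = UNIV"
  unfolding int_metric_def by (rule Metric_space.mspace_metric[OF Metric_space_int])

lemma mdist_int_metric [simp]: "mdist int_metric x y = real_of_int \<bar>x - y\<bar>"
  unfolding int_metric_def by (simp only: Metric_space.mdist_metric[OF Metric_space_int])

lemma UDBG_submetric_int_metric: "UDBG (submetric int_metric S)"
  unfolding UDBG_def
proof (intro conjI allI impI)
  show "\<exists>\<epsilon>>0. \<forall>x\<in>mspace (submetric int_metric S). \<forall>y\<in>mspace (submetric int_metric S).
          mdist (submetric int_metric S) x y < \<epsilon> \<longleftrightarrow> x = y"
    by (intro exI[of _ 1]) auto
next
  fix r :: real assume "r > 0"
  let ?B = "mball_of (submetric int_metric S)"
  have sub: "?B x r \<subseteq> {x - \<lceil>r\<rceil>..x + \<lceil>r\<rceil>}" for x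
    by (simp add: subset_iff) linarith
  have "finite (?B x r) \<and> real (card (?B x r)) < real (nat (2 * \<lceil>r\<rceil> + 1)) + 1" for x
    using finite_subset[OF sub[of x]] card_mono[OF _ sub[of x]] by (simp add: algebra_simps)
  then show "\<exists>K::real. K > 0 \<and> (\<forall>x\<in>mspace (submetric int_metric S).
      finite (?B x r) \<and> real (card (?B x r)) < K)"
    by (intro exI[of _ "real (nat (2 * \<lceil>r\<rceil> + 1)) + 1"]) auto
qed

lemma UDBG_int_metric: "UDBG int_metric"
  using UDBG_submetric_int_metric[of UNIV] by simp

lemma finite_chain_support_near:
  assumes X: "UDBG X" and c: "c \<in> uf_chains n X" and p: "p \<in> mspace X"
  shows "finite {x. c x \<noteq> 0 \<and> (\<exists>q\<in>set x. mdist X p q \<le> r)}"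
proof -
  obtain \<rho> where \<rho>: "\<rho> > 0" and
      far: "\<And>x. x \<in> uf_tuples n X \<Longrightarrow> (MAX (p, q)\<in>set x \<times> set x. mdist X p q) > \<rho> \<Longrightarrow> c x = 0"
    and supp: "\<And>x. c x \<noteq> 0 \<Longrightarrow> x \<in> uf_tuples n X"
    using c by (auto simp: uf_chains_def)
  have near: "mdist X s q \<le> \<rho>" if "c x \<noteq> 0" "s \<in> set x" "q \<in> set x" for x s q
  proof (rule order_trans)
    show "mdist X s q \<le> (MAX (p, q)\<in>set x \<times> set x. mdist X p q)"
      using that by (intro Max_ge) (auto intro!: image_eqI[of _ _ "(s, q)"])
    show "(MAX (p, q)\<in>set x \<times> set x. mdist X p q) \<le> \<rho>"
      using far supp that(1) by force
  qed
  let ?B = "mball_of X p (\<bar>r\<bar> + \<rho> + 1)"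
  have "finite ?B"
  proof -
    have "\<bar>r\<bar> + \<rho> + 1 > 0" using \<rho> by simp
    then show ?thesis using X p unfolding UDBG_def by blast
  qed
  then have "finite {x. set x \<subseteq> ?B \<and> length x = Suc n}"
    by (rule finite_lists_length_eq)
  moreover have "{x. c x \<noteq> 0 \<and> (\<exists>q\<in>set x. mdist X p q \<le> r)} \<subseteq> {x. set x \<subseteq> ?B \<and> length x = Suc n}"
  proof clarify
    fix x q assume x: "c x \<noteq> 0" "q \<in> set x" "mdist X p q \<le> r"
    have X: "set x \<subseteq> mspace X" "length x = Suc n"
      using supp[OF x(1)] by (auto simp: uf_tuples_def)
    have "mdist X p s < \<bar>r\<bar> + \<rho> + 1" if "s \<in> set x" for s
    proof -
      have "mdist X p s \<le> mdist X p q + mdist X q s"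
        using X(1) x(2) that p by (intro mdist_triangle) auto
      then show ?thesis using near[OF x(1,2) that] x(3) by linarith
    qed
    then show "set x \<subseteq> ?B \<and> length x = Suc n"
      using X p by auto
  qed
  ultimately show ?thesis by (rule finite_subset[rotated])
qed

lemma finite_face_fibre:
  assumes X: "UDBG X" and c: "c \<in> uf_chains n X" and n: "n > 0"
  shows "finite {x. c x \<noteq> 0 \<and> face j x = y}"
proof (cases "{x. c x \<noteq> 0 \<and> face j x = y} = {}")
  case False
  then obtain x where x: "c x \<noteq> 0" "face j x = y" by blast
  have len: "length x = Suc n" "set x \<subseteq> mspace X"
    using c x(1) by (auto simp: uf_chains_def uf_tuples_def)
  have sub: "set (face j x) \<subseteq> set x" for x :: "'a list"
    unfolding face_def using set_take_subset[of j x] set_drop_subset[of "Suc j" x] by auto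
  have "length y \<noteq> 0"
    using x(2) len(1) n by (auto simp: face_def)
  then have y: "y \<noteq> []" "hd y \<in> mspace X"
    using sub[of x] x(2) len(2) hd_in_set[of y] by blast+
  have "hd y \<in> set x" if "face j x = y" for x
    using sub[of x] y(1) that hd_in_set[of y] by blast
  then have "{x. c x \<noteq> 0 \<and> face j x = y} \<subseteq> {x. c x \<noteq> 0 \<and> (\<exists>q\<in>set x. mdist X (hd y) q \<le> 0)}"
    using mdist_zero[OF y(2) y(2)] by force
  then show ?thesis
    using finite_chain_support_near[OF X c y(2)] by (rule finite_subset)
next
  case True
  then show ?thesis by (simp only: finite.emptyI)
qed

lemma finite_map_fibre:
  assumes X: "UDBG X" and f: "quasi_isometric_embedding X Y f" and c: "c \<in> uf_chains n X"
  shows "finite {x. c x \<noteq> 0 \<and> map f x = y}"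
proof (cases "{x. c x \<noteq> 0 \<and> map f x = y} = {}")
  case False
  then obtain z where z: "c z \<noteq> 0" "map f z = y" by blast
  have tup: "length x = Suc n \<and> set x \<subseteq> mspace X" if "c x \<noteq> 0" for x
    using c that by (auto simp: uf_chains_def uf_tuples_def)
  obtain C D where C: "C > 0" and CD: "\<And>x x'. x \<in> mspace X \<Longrightarrow> x' \<in> mspace X \<Longrightarrow>
      1 / C * mdist X x x' - D \<le> mdist Y (f x) (f x')"
    using f unfolding quasi_isometric_embedding_def by metis
  have p: "hd z \<in> mspace X" using tup[OF z(1)] by (cases z) auto
  have "\<exists>q\<in>set x. mdist X (hd z) q \<le> C * D" if x: "c x \<noteq> 0" "map f x = y" for x
  proof
    show q: "hd x \<in> set x" using tup[OF x(1)] by (cases x) auto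
    have "f (hd x) = f (hd z)"
      using x(2) z(2) tup[OF x(1)] tup[OF z(1)] by (cases x; cases z) auto
    moreover have "f (hd x) \<in> mspace Y"
      using f q tup[OF x(1)] by (auto simp: quasi_isometric_embedding_def)
    ultimately have "f (hd x) = f (hd z)" "mdist Y (f (hd z)) (f (hd z)) = 0"
      by (simp_all only: mdist_zero)
    then have "mdist X (hd z) (hd x) / C \<le> D"
      using CD[OF p subsetD[OF conjunct2[OF tup[OF x(1)]] q]] by simp
    then show "mdist X (hd z) (hd x) \<le> C * D"
      using C by (simp add: field_simps)
  qed
  then have "{x. c x \<noteq> 0 \<and> map f x = y} \<subseteq> {x. c x \<noteq> 0 \<and> (\<exists>q\<in>set x. mdist X (hd z) q \<le> C * D)}"
    by auto
  then show ?thesis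
    using finite_chain_support_near[OF X c p] by (rule finite_subset)
next
  case True
  then show ?thesis by (simp only: finite.emptyI)
qed

end

theory Submission
  imports Defs
begin

text \<open>The squares are so sparse that they can be moved out of the way at no asymptotic cost in norm,
  yet there are infinitely many of them, which is too many for a bijection of bounded displacement.

  For the homological part let \<open>S\<close> be a subset of a UDBG space \<open>X\<close>. A retraction \<open>r\<close> of \<open>X\<close> onto \<open>S\<close>
  that moves points by a bounded amount is a coarse inverse of the inclusion. On chains the inclusion
  followed by \<open>r\<close> is literally the identity, and \<open>r\<close> followed by the inclusion is chain homotopic to
  the identity by the prism operator (\<open>prism_homotopy\<close>). Hence the inclusion is a linear isomorphism in
  homology (\<open>inclusion_linear_isomorphism\<close>). It does not increase the semi-norm, because a cycle
  of \<open>S\<close> has the same norm when it is regarded as a cycle of \<open>X\<close>.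

  The converse inequality needs, for every cycle \<open>c\<close> of \<open>X\<close>, a homologous cycle of \<open>S\<close> of almost the
  same norm. A single push-forward along \<open>r\<close> is not enough, since coefficients may pile up at
  the tuples that involve a point hit by \<open>r\<close> from outside \<open>S\<close>. With real coefficients one may average the
  push-forwards along many retractions \<open>r\<^sub>0, \<dots>, r\<^sub>N\<^sub>-\<^sub>1\<close> that send the points outside \<open>S\<close> to pairwise
  different places, for different points as well as for different indices. Then a tuple
  of \<open>k + 1\<close> points is affected by at most \<open>k + 1\<close> of the \<open>N\<close> retractions, each of which multiplies the norm
  by at most \<open>2 ^ (k + 1)\<close>, and the norm of the average exceeds that of \<open>c\<close> only by
  a factor \<open>1 + O(1/N)\<close> (\<open>uf_norm_average\<close>, \<open>inclusion_isometric\<close>).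
  For the squares, \<open>r\<^sub>j\<close> shifts a square \<open>a \<ge> N\<^sup>2\<close> into the gap behind it, to \<open>a + j + 1\<close>, and sends the
  finitely many smaller squares to negative numbers (\<open>square_shift_dispersing\<close>).

  For the last part, a bilipschitz equivalence \<open>g\<close> uniformly close to the inclusion would map the
  non-squares onto \<open>\<int>\<close> with displacement at most some \<open>D\<close>. Then an interval of length \<open>L\<close> is covered by
  the images of the non-squares in an interval of length \<open>L + 2 D\<close>; this is impossible once
  that interval contains more than \<open>2 D\<close> squares (\<open>no_close_surjection\<close>).\<close>

section \<open>Operators of bounded displacement on uniformly finite chains\<close>

text \<open>Faces, push-forwards along maps close to the identity, and prisms are all of this kind. The bound
  is what makes the extension of \<open>g\<close> to infinite sums harmless: a tuple mapped to \<open>y\<close> has an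
  entry near \<open>y\<close>, so in the support of a chain the number of such tuples is bounded uniformly in \<open>y\<close>.\<close>

definition controlled :: "'a metric \<Rightarrow> nat \<Rightarrow> nat \<Rightarrow> ('a list \<Rightarrow> 'a list) \<Rightarrow> bool" where
  "controlled X n m g \<longleftrightarrow>
     (\<exists>D. \<forall>x\<in>uf_tuples n X. g x \<in> uf_tuples m X \<and> (\<forall>p\<in>set (g x). \<exists>q\<in>set x. mdist X p q \<le> D))"

lemma mdist_self: "p \<in> mspace X \<Longrightarrow> mdist X p p = 0"
  by (simp only: mdist_zero)

text \<open>A form of the chain conditions without maxima and suprema; the diameter bound need not be
  positive, since it can always be enlarged.\<close>

lemma uf_chains_iff:
  "c \<in> uf_chains n X \<longleftrightarrow>
     (\<forall>x. c x \<noteq> 0 \<longrightarrow> x \<in> uf_tuples n X) \<and> (\<exists>B. \<forall>x. \<bar>c x\<bar> \<le> B) \<and>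
     (\<exists>\<rho>. \<forall>x. c x \<noteq> 0 \<longrightarrow> (\<forall>p\<in>set x. \<forall>q\<in>set x. mdist X p q \<le> \<rho>))"
proof -
  have max: "(MAX (p, q)\<in>set x \<times> set x. mdist X p q) \<le> \<rho> \<longleftrightarrow> (\<forall>p\<in>set x. \<forall>q\<in>set x. mdist X p q \<le> \<rho>)"
    if "x \<in> uf_tuples n X" for x \<rho>
  proof -
    have "x \<noteq> []" using that by (auto simp: uf_tuples_def)
    then show ?thesis by (subst Max_le_iff) auto
  qed
  have diam: "(\<exists>\<rho>>0. \<forall>x\<in>uf_tuples n X. (MAX (p, q)\<in>set x \<times> set x. mdist X p q) > \<rho> \<longrightarrow> c x = 0) \<longleftrightarrow>
        (\<exists>\<rho>. \<forall>x. c x \<noteq> 0 \<longrightarrow> (\<forall>p\<in>set x. \<forall>q\<in>set x. mdist X p q \<le> \<rho>))" (is "?L \<longleftrightarrow> ?R")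
    if supp: "\<forall>x. c x \<noteq> 0 \<longrightarrow> x \<in> uf_tuples n X"
  proof
    assume ?L
    then obtain \<rho> where "\<forall>x\<in>uf_tuples n X. (MAX (p, q)\<in>set x \<times> set x. mdist X p q) > \<rho> \<longrightarrow> c x = 0"
      by blast
    then show ?R
      using supp max by (intro exI[of _ \<rho>]) (metis not_le_imp_less)
  next
    assume ?R
    then obtain \<rho> where \<rho>: "\<And>x p q. c x \<noteq> 0 \<Longrightarrow> p \<in> set x \<Longrightarrow> q \<in> set x \<Longrightarrow> mdist X p q \<le> \<rho>"
      by blast
    have "c x = 0" if "x \<in> uf_tuples n X" "(MAX (p, q)\<in>set x \<times> set x. mdist X p q) > \<bar>\<rho>\<bar> + 1" for x
    proof (rule ccontr)
      assume "c x \<noteq> 0"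
      then have "(MAX (p, q)\<in>set x \<times> set x. mdist X p q) \<le> \<bar>\<rho>\<bar> + 1"
        unfolding max[OF that(1)] using \<rho> by (smt (verit))
      then show False using that(2) by simp
    qed
    then show ?L by (intro exI[of _ "\<bar>\<rho>\<bar> + 1"]) auto
  qed
  have bdd: "bdd_above (range (\<lambda>x. \<bar>c x\<bar>)) \<longleftrightarrow> (\<exists>B. \<forall>x. \<bar>c x\<bar> \<le> B)"
    by (auto simp: bdd_above_def)
  have supp: "(\<forall>x. x \<notin> uf_tuples n X \<longrightarrow> c x = 0) \<longleftrightarrow> (\<forall>x. c x \<noteq> 0 \<longrightarrow> x \<in> uf_tuples n X)"
    by blast
  show ?thesis
    unfolding uf_chains_def mem_Collect_eq supp bdd by (rule conj_cong[OF refl], simp only: diam)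
qed

lemma uf_chainsI:
  assumes "\<And>x. c x \<noteq> 0 \<Longrightarrow> x \<in> uf_tuples n X" "\<And>x. \<bar>c x\<bar> \<le> B"
    and "\<And>x p q. c x \<noteq> 0 \<Longrightarrow> p \<in> set x \<Longrightarrow> q \<in> set x \<Longrightarrow> mdist X p q \<le> \<rho>"
  shows "c \<in> uf_chains n X"
proof -
  have "\<exists>B. \<forall>x. \<bar>c x\<bar> \<le> B" using assms(2) by blast
  moreover have "\<exists>\<rho>. \<forall>x. c x \<noteq> 0 \<longrightarrow> (\<forall>p\<in>set x. \<forall>q\<in>set x. mdist X p q \<le> \<rho>)"
    using assms(3) by (intro exI[of _ \<rho>]) simp
  ultimately show ?thesis unfolding uf_chains_iff using assms(1) by simp
qed

text \<open>The tuples in the support that meet a ball are contained in a slightly larger ball, whose cardinality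
  is bounded independently of its centre. This uniformity is what bounds the coefficients of extended sums.\<close>

lemma card_chain_support_near:
  assumes X: "UDBG X" and c: "c \<in> uf_chains n X"
  obtains K :: real where
    "\<And>p. p \<in> mspace X \<Longrightarrow> real (card {x. c x \<noteq> 0 \<and> (\<exists>q\<in>set x. mdist X p q \<le> r)}) \<le> K"
proof -
  obtain \<rho> where supp: "\<And>x. c x \<noteq> 0 \<Longrightarrow> x \<in> uf_tuples n X"
    and near: "\<And>x p q. c x \<noteq> 0 \<Longrightarrow> p \<in> set x \<Longrightarrow> q \<in> set x \<Longrightarrow> mdist X p q \<le> \<rho>"
    using c unfolding uf_chains_iff by blast
  define R where "R = \<bar>r\<bar> + \<bar>\<rho>\<bar> + 1"
  have R: "R > 0" unfolding R_def by linarith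
  obtain K where K: "\<And>p. p \<in> mspace X \<Longrightarrow> finite (mball_of X p R) \<and> real (card (mball_of X p R)) < K"
    using X[unfolded UDBG_def, THEN conjunct2, rule_format, OF R] by (elim exE conjE) blast
  show thesis
  proof
    fix p assume p: "p \<in> mspace X"
    let ?B = "mball_of X p R"
    have "{x. c x \<noteq> 0 \<and> (\<exists>q\<in>set x. mdist X p q \<le> r)} \<subseteq> {x. set x \<subseteq> ?B \<and> length x = Suc n}"
    proof clarify
      fix x q assume x: "c x \<noteq> 0" "q \<in> set x" "mdist X p q \<le> r"
      have X: "set x \<subseteq> mspace X" "length x = Suc n"
        using supp[OF x(1)] by (auto simp: uf_tuples_def)
      have "mdist X p s < R" if "s \<in> set x" for s
      proof -
        have "mdist X p s \<le> mdist X p q + mdist X q s"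
          using X(1) x(2) that p by (intro mdist_triangle) auto
        then show ?thesis using near[OF x(1,2) that] x(3) unfolding R_def by linarith
      qed
      then show "set x \<subseteq> ?B \<and> length x = Suc n"
        using X p by auto
    qed
    then have "card {x. c x \<noteq> 0 \<and> (\<exists>q\<in>set x. mdist X p q \<le> r)} \<le> card {x. set x \<subseteq> ?B \<and> length x = Suc n}"
      by (rule card_mono[OF finite_lists_length_eq[OF conjunct1[OF K[OF p]]]])
    also have "\<dots> = card ?B ^ Suc n"
      by (rule card_lists_length_eq[OF conjunct1[OF K[OF p]]])
    finally have "real (card {x. c x \<noteq> 0 \<and> (\<exists>q\<in>set x. mdist X p q \<le> r)}) \<le> real (card ?B) ^ Suc n"
      unfolding of_nat_power[symmetric] by (rule of_nat_mono)
    also have "\<dots> \<le> K ^ Suc n"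
      using K[OF p] by (intro power_mono) auto
    finally show "real (card {x. c x \<noteq> 0 \<and> (\<exists>q\<in>set x. mdist X p q \<le> r)}) \<le> K ^ Suc n" .
  qed
qed

lemma controlled_fibre_subset:
  assumes g: "controlled X n m g" and c: "c \<in> uf_chains n X"
  obtains D where
    "\<And>y. {x. c x \<noteq> 0 \<and> g x = y} \<noteq> {} \<Longrightarrow> y \<in> uf_tuples m X \<and> hd y \<in> mspace X \<and>
        {x. c x \<noteq> 0 \<and> g x = y} \<subseteq> {x. c x \<noteq> 0 \<and> (\<exists>q\<in>set x. mdist X (hd y) q \<le> D)}"
proof -
  obtain D where D: "\<And>x. x \<in> uf_tuples n X \<Longrightarrow>
      g x \<in> uf_tuples m X \<and> (\<forall>p\<in>set (g x). \<exists>q\<in>set x. mdist X p q \<le> D)"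
    using g unfolding controlled_def by blast
  have hd: "hd y \<in> set y" if "y \<in> uf_tuples m X" for y
    using that by (cases y) (auto simp: uf_tuples_def)
  show thesis
  proof
    fix y assume "{x. c x \<noteq> 0 \<and> g x = y} \<noteq> {}"
    then have y: "y \<in> uf_tuples m X"
      using c D unfolding uf_chains_iff by blast
    then show "y \<in> uf_tuples m X \<and> hd y \<in> mspace X \<and>
        {x. c x \<noteq> 0 \<and> g x = y} \<subseteq> {x. c x \<noteq> 0 \<and> (\<exists>q\<in>set x. mdist X (hd y) q \<le> D)}"
      using c D hd[OF y] unfolding uf_chains_iff by (auto simp: uf_tuples_def)
  qed
qed

lemma finite_controlled_fibre:
  assumes X: "UDBG X" and g: "controlled X n m g" and c: "c \<in> uf_chains n X"
  shows "finite {x. c x \<noteq> 0 \<and> g x = y}"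
proof (cases "{x. c x \<noteq> 0 \<and> g x = y} = {}")
  case False
  obtain D where D: "\<And>y. {x. c x \<noteq> 0 \<and> g x = y} \<noteq> {} \<Longrightarrow> y \<in> uf_tuples m X \<and> hd y \<in> mspace X \<and>
        {x. c x \<noteq> 0 \<and> g x = y} \<subseteq> {x. c x \<noteq> 0 \<and> (\<exists>q\<in>set x. mdist X (hd y) q \<le> D)}"
    by (rule controlled_fibre_subset[OF g c]) blast
  have "hd y \<in> mspace X" using D[OF False] by blast
  from finite_chain_support_near[OF X c this, of D] show ?thesis
    by (rule finite_subset[rotated]) (use D[OF False] in blast)
next
  case True
  then show ?thesis by (simp only: finite.emptyI)
qed

lemma extend_to_sums_nonzero:
  assumes "extend_to_sums g c y \<noteq> 0"
  obtains x where "c x \<noteq> 0" "g x = y"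
  using assms unfolding extend_to_sums_def by (metis (mono_tags, lifting) mem_Collect_eq sum.neutral)

text \<open>The set of summands may be enlarged by tuples with coefficient zero. This allows sums for
  different chains to be taken over a common index set.\<close>

lemma extend_to_sums_eq_sum:
  assumes "finite F" "{x. c x \<noteq> 0 \<and> g x = y} \<subseteq> F" "F \<subseteq> {x. g x = y}"
  shows "extend_to_sums g c y = sum c F"
  unfolding extend_to_sums_def using assms by (intro sum.mono_neutral_left) auto

lemma extend_to_sums_chain:
  assumes X: "UDBG X" and g: "controlled X n m g" and c: "c \<in> uf_chains n X"
  shows "extend_to_sums g c \<in> uf_chains m X"
proof -
  obtain D where D: "\<And>x. x \<in> uf_tuples n X \<Longrightarrow>
      g x \<in> uf_tuples m X \<and> (\<forall>p\<in>set (g x). \<exists>q\<in>set x. mdist X p q \<le> D)"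
    using g unfolding controlled_def by blast
  obtain B \<rho> where supp: "\<And>x. c x \<noteq> 0 \<Longrightarrow> x \<in> uf_tuples n X"
    and B: "\<And>x. \<bar>c x\<bar> \<le> B"
    and near: "\<And>x p q. c x \<noteq> 0 \<Longrightarrow> p \<in> set x \<Longrightarrow> q \<in> set x \<Longrightarrow> mdist X p q \<le> \<rho>"
    using c unfolding uf_chains_iff by blast
  have B0: "0 \<le> B" using B by (meson abs_ge_zero order_trans)
  have tup: "y \<in> uf_tuples m X" if "extend_to_sums g c y \<noteq> 0" for y
    using that by (rule extend_to_sums_nonzero) (use D supp in blast)
  \<comment> \<open>Two points of an image tuple are compared through nearby points of the original tuple.\<close>
  have diam: "mdist X p q \<le> D + \<rho> + D"
    if y: "extend_to_sums g c y \<noteq> 0" and pq: "p \<in> set y" "q \<in> set y" for y p q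
  proof -
    obtain x where x: "c x \<noteq> 0" "g x = y" by (rule extend_to_sums_nonzero[OF y])
    obtain p' q' where p': "p' \<in> set x" "mdist X p p' \<le> D" and q': "q' \<in> set x" "mdist X q q' \<le> D"
      using D[OF supp[OF x(1)]] x(2) pq by blast
    have M: "p \<in> mspace X" "q \<in> mspace X" "p' \<in> mspace X" "q' \<in> mspace X"
      using D[OF supp[OF x(1)]] supp[OF x(1)] x(2) pq p'(1) q'(1)
      by (auto simp: uf_tuples_def)
    have "mdist X p q \<le> mdist X p p' + mdist X p' q" "mdist X p' q \<le> mdist X p' q' + mdist X q' q"
      using M mdist_triangle by metis+
    moreover have "mdist X q' q \<le> D" using q'(2) by (simp add: mdist_commute)
    ultimately show ?thesis using near[OF x(1) p'(1) q'(1)] p'(2) by linarith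
  qed
  obtain D' where D': "\<And>y. {x. c x \<noteq> 0 \<and> g x = y} \<noteq> {} \<Longrightarrow> y \<in> uf_tuples m X \<and> hd y \<in> mspace X \<and>
        {x. c x \<noteq> 0 \<and> g x = y} \<subseteq> {x. c x \<noteq> 0 \<and> (\<exists>q\<in>set x. mdist X (hd y) q \<le> D')}"
    by (rule controlled_fibre_subset[OF g c]) blast
  obtain K where K: "\<And>p. p \<in> mspace X \<Longrightarrow> real (card {x. c x \<noteq> 0 \<and> (\<exists>q\<in>set x. mdist X p q \<le> D')}) \<le> K"
    by (rule card_chain_support_near[OF X c, of D']) blast
  have bound: "\<bar>extend_to_sums g c y\<bar> \<le> \<bar>K\<bar> * B" for y
  proof (cases "{x. c x \<noteq> 0 \<and> g x = y} = {}")
    case True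
    then show ?thesis unfolding extend_to_sums_def using B0 by (simp only: sum.empty) simp
  next
    case False
    note y = D'[OF False]
    have "real (card {x. c x \<noteq> 0 \<and> g x = y}) \<le> real (card {x. c x \<noteq> 0 \<and> (\<exists>q\<in>set x. mdist X (hd y) q \<le> D')})"
      using card_mono[OF finite_chain_support_near[OF X c conjunct1[OF conjunct2[OF y]]] conjunct2[OF conjunct2[OF y]]]
      by (rule of_nat_mono)
    also have "\<dots> \<le> K"
      using y by (intro K) blast
    finally have card: "real (card {x. c x \<noteq> 0 \<and> g x = y}) \<le> K" .
    have "\<bar>extend_to_sums g c y\<bar> \<le> (\<Sum>x | c x \<noteq> 0 \<and> g x = y. \<bar>c x\<bar>)"
      unfolding extend_to_sums_def by (rule sum_abs)
    also have "\<dots> \<le> real (card {x. c x \<noteq> 0 \<and> g x = y}) * B"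
      by (rule sum_bounded_above) (rule B)
    also have "\<dots> \<le> \<bar>K\<bar> * B"
      using card B0 by (intro mult_right_mono) auto
    finally show ?thesis .
  qed
  show ?thesis
    by (rule uf_chainsI[OF tup bound diam])
qed

lemma controlled_comp:
  assumes g: "controlled X n m g" and h: "controlled X m l h"
  shows "controlled X n l (h \<circ> g)"
proof -
  obtain D where D: "\<And>x. x \<in> uf_tuples n X \<Longrightarrow>
      g x \<in> uf_tuples m X \<and> (\<forall>p\<in>set (g x). \<exists>q\<in>set x. mdist X p q \<le> D)"
    using g unfolding controlled_def by blast
  obtain E where E: "\<And>x. x \<in> uf_tuples m X \<Longrightarrow>
      h x \<in> uf_tuples l X \<and> (\<forall>p\<in>set (h x). \<exists>q\<in>set x. mdist X p q \<le> E)"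
    using h unfolding controlled_def by blast
  have "\<exists>q\<in>set x. mdist X p q \<le> E + D" if x: "x \<in> uf_tuples n X" and p: "p \<in> set (h (g x))" for x p
  proof -
    obtain s where s: "s \<in> set (g x)" "mdist X p s \<le> E" using E D x p by blast
    obtain q where q: "q \<in> set x" "mdist X s q \<le> D" using D x s(1) by blast
    have "p \<in> mspace X" "s \<in> mspace X" "q \<in> mspace X"
      using D[OF x] E[of "g x"] x p s(1) q(1) by (auto simp: uf_tuples_def)
    then have "mdist X p q \<le> mdist X p s + mdist X s q" by (rule mdist_triangle)
    then show ?thesis using s(2) q by (intro bexI[of _ q]) auto
  qed
  then show ?thesis unfolding controlled_def using D E by (intro exI[of _ "E + D"]) auto
qed

text \<open>Functoriality is a regrouping of the finite sum over the fibre of the composite by the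
  intermediate tuple.\<close>

lemma extend_to_sums_comp:
  assumes X: "UDBG X" and g: "controlled X n m g" and h: "controlled X m l h"
    and c: "c \<in> uf_chains n X"
  shows "extend_to_sums h (extend_to_sums g c) = extend_to_sums (h \<circ> g) c"
proof
  fix y
  define F where "F = {x. c x \<noteq> 0 \<and> (h \<circ> g) x = y}"
  have F: "finite F"
    unfolding F_def using finite_controlled_fibre[OF X controlled_comp[OF g h] c] .
  have "extend_to_sums h (extend_to_sums g c) y = sum (extend_to_sums g c) (g ` F)"
  proof (rule extend_to_sums_eq_sum)
    show "{z. extend_to_sums g c z \<noteq> 0 \<and> h z = y} \<subseteq> g ` F"
      unfolding F_def by (auto elim!: extend_to_sums_nonzero)
  qed (use F in \<open>auto simp: F_def\<close>)
  also have "\<dots> = (\<Sum>z\<in>g ` F. sum c {x \<in> F. g x = z})"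
  proof (rule sum.cong)
    fix z assume "z \<in> g ` F"
    then have "{x. c x \<noteq> 0 \<and> g x = z} = {x \<in> F. g x = z}" unfolding F_def by auto
    then show "extend_to_sums g c z = sum c {x \<in> F. g x = z}" unfolding extend_to_sums_def by simp
  qed simp
  also have "\<dots> = sum c F" using F by (rule sum.image_gen[symmetric])
  also have "\<dots> = extend_to_sums (h \<circ> g) c y" unfolding extend_to_sums_def F_def ..
  finally show "extend_to_sums h (extend_to_sums g c) y = extend_to_sums (h \<circ> g) c y" .
qed

lemma extend_to_sums_cong:
  assumes "c \<in> uf_chains n X" "\<And>x. x \<in> uf_tuples n X \<Longrightarrow> g x = h x"
  shows "extend_to_sums g c = extend_to_sums h c"
proof
  fix y
  have "{x. c x \<noteq> 0 \<and> g x = y} = {x. c x \<noteq> 0 \<and> h x = y}"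
    using assms unfolding uf_chains_iff by auto
  then show "extend_to_sums g c y = extend_to_sums h c y" by (simp add: extend_to_sums_def)
qed

lemma extend_to_sums_id: "extend_to_sums (\<lambda>x. x) c = c"
proof
  fix y
  have "extend_to_sums (\<lambda>x. x) c y = sum c {y}" by (rule extend_to_sums_eq_sum) auto
  then show "extend_to_sums (\<lambda>x. x) c y = c y" by simp
qed

text \<open>Linearity holds because finitely many chains have a common finite set of relevant tuples
  over each \<open>y\<close>.\<close>

lemma extend_to_sums_sum:
  assumes X: "UDBG X" and g: "controlled X n m g" and J: "finite J"
    and c: "\<And>j. j \<in> J \<Longrightarrow> c j \<in> uf_chains n X"
  shows "extend_to_sums g (\<lambda>x. \<Sum>j\<in>J. w j * c j x) = (\<lambda>y. \<Sum>j\<in>J. w j * extend_to_sums g (c j) y)"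
proof
  fix y
  define F where "F = (\<Union>j\<in>J. {x. c j x \<noteq> 0 \<and> g x = y})"
  have F: "finite F"
    unfolding F_def using J finite_controlled_fibre[OF X g c] by auto
  have "extend_to_sums g (\<lambda>x. \<Sum>j\<in>J. w j * c j x) y = (\<Sum>x\<in>F. \<Sum>j\<in>J. w j * c j x)"
  proof (rule extend_to_sums_eq_sum[OF F])
    show "{x. (\<Sum>j\<in>J. w j * c j x) \<noteq> 0 \<and> g x = y} \<subseteq> F"
      unfolding F_def by (auto elim!: sum.not_neutral_contains_not_neutral)
  qed (auto simp: F_def)
  also have "\<dots> = (\<Sum>j\<in>J. w j * (\<Sum>x\<in>F. c j x))"
    by (subst sum.swap) (simp add: sum_distrib_left)
  also have "\<dots> = (\<Sum>j\<in>J. w j * extend_to_sums g (c j) y)"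
    by (intro sum.cong refl arg_cong2[where f = "(*)"] extend_to_sums_eq_sum[OF F, symmetric])
      (auto simp: F_def)
  finally show "extend_to_sums g (\<lambda>x. \<Sum>j\<in>J. w j * c j x) y = (\<Sum>j\<in>J. w j * extend_to_sums g (c j) y)" .
qed

lemma uf_chains_sum:
  assumes J: "finite J" and c: "\<And>j. j \<in> J \<Longrightarrow> c j \<in> uf_chains n X"
  shows "(\<lambda>x. \<Sum>j\<in>J. w j * c j x) \<in> uf_chains n X"
proof -
  have "\<forall>j. \<exists>B \<rho>. j \<in> J \<longrightarrow> (\<forall>x. \<bar>c j x\<bar> \<le> B) \<and>
      (\<forall>x. c j x \<noteq> 0 \<longrightarrow> (\<forall>p\<in>set x. \<forall>q\<in>set x. mdist X p q \<le> \<rho>))"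
    using c unfolding uf_chains_iff by blast
  then obtain B \<rho> where B: "\<And>j x. j \<in> J \<Longrightarrow> \<bar>c j x\<bar> \<le> B j"
    and \<rho>: "\<And>j x p q. j \<in> J \<Longrightarrow> c j x \<noteq> 0 \<Longrightarrow> p \<in> set x \<Longrightarrow> q \<in> set x \<Longrightarrow> mdist X p q \<le> \<rho> j"
    by metis
  have ex: "\<exists>j\<in>J. c j x \<noteq> 0" if "(\<Sum>j\<in>J. w j * c j x) \<noteq> 0" for x
    using that by (auto elim!: sum.not_neutral_contains_not_neutral)
  have "\<bar>\<Sum>j\<in>J. w j * c j x\<bar> \<le> (\<Sum>j\<in>J. \<bar>w j\<bar> * B j)" for x
    by (rule order_trans[OF sum_abs]) (auto intro!: sum_mono mult_left_mono simp: abs_mult B)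
  moreover have "mdist X p q \<le> (\<Sum>j\<in>J. \<bar>\<rho> j\<bar>)"
    if x: "(\<Sum>j\<in>J. w j * c j x) \<noteq> 0" "p \<in> set x" "q \<in> set x" for x p q
  proof -
    obtain j where j: "j \<in> J" "c j x \<noteq> 0" using ex[OF x(1)] by blast
    have "mdist X p q \<le> \<bar>\<rho> j\<bar>" using \<rho>[OF j x(2,3)] by linarith
    also have "\<dots> \<le> (\<Sum>j\<in>J. \<bar>\<rho> j\<bar>)" using j(1) J by (intro member_le_sum) auto
    finally show ?thesis .
  qed
  moreover have "x \<in> uf_tuples n X" if "(\<Sum>j\<in>J. w j * c j x) \<noteq> 0" for x
    using ex[OF that] c unfolding uf_chains_iff by blast
  ultimately show ?thesis
    by (intro uf_chainsI)
qed

lemma controlled_face: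
  assumes "j \<le> Suc n"
  shows "controlled X (Suc n) n (face j)"
  unfolding controlled_def
proof (intro exI[of _ 0] ballI conjI)
  fix x assume x: "x \<in> uf_tuples (Suc n) X"
  have sub: "set (face j x) \<subseteq> set x"
    unfolding face_def using set_take_subset[of j x] set_drop_subset[of "Suc j" x] by auto
  then show "face j x \<in> uf_tuples n X"
    using x assms by (auto simp: uf_tuples_def face_def)
  fix p assume "p \<in> set (face j x)"
  then show "\<exists>q\<in>set x. mdist X p q \<le> 0"
    using sub x by (intro bexI[of _ p]) (auto simp: uf_tuples_def subset_iff mdist_self)
qed

lemma uf_boundary_sum:
  assumes X: "UDBG X" and J: "finite J" and c: "\<And>j. j \<in> J \<Longrightarrow> c j \<in> uf_chains n X"
  shows "uf_boundary n (\<lambda>x. \<Sum>j\<in>J. w j * c j x) = (\<lambda>y. \<Sum>j\<in>J. w j * uf_boundary n (c j) y)"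
proof (cases n)
  case 0
  then show ?thesis by (simp add: uf_boundary_def)
next
  case (Suc m)
  have *: "extend_to_sums (face i) (\<lambda>x. \<Sum>j\<in>J. w j * c j x) y = (\<Sum>j\<in>J. w j * extend_to_sums (face i) (c j) y)"
    if "i \<le> n" for i y
  proof -
    have i: "i \<le> Suc m" using that Suc by simp
    show ?thesis
      using fun_cong[OF extend_to_sums_sum[OF X controlled_face[OF i] J c[unfolded Suc]]] .
  qed
  have "(\<Sum>i\<le>n. (- 1) ^ i * extend_to_sums (face i) (\<lambda>x. \<Sum>j\<in>J. w j * c j x) y)
      = (\<Sum>j\<in>J. w j * (\<Sum>i\<le>n. (- 1) ^ i * extend_to_sums (face i) (c j) y))" for y
    by (simp add: * sum_distrib_left) (subst sum.swap, simp add: mult.left_commute)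
  then show ?thesis using Suc by (simp add: uf_boundary_def)
qed

lemma controlled_map:
  assumes "f \<in> mspace X \<rightarrow> mspace X" "\<And>x. x \<in> mspace X \<Longrightarrow> mdist X (f x) x \<le> D"
  shows "controlled X n n (map f)"
  unfolding controlled_def
proof (intro exI[of _ D] ballI conjI)
  fix x assume x: "x \<in> uf_tuples n X"
  then show "map f x \<in> uf_tuples n X" using assms(1) by (auto simp: uf_tuples_def)
  fix p assume "p \<in> set (map f x)"
  then show "\<exists>q\<in>set x. mdist X p q \<le> D" using x assms(2) by (auto simp: uf_tuples_def)
qed

lemma uf_boundary_extend_map:
  assumes X: "UDBG X" and f: "f \<in> mspace X \<rightarrow> mspace X" "\<And>x. x \<in> mspace X \<Longrightarrow> mdist X (f x) x \<le> D"
    and c: "c \<in> uf_chains n X"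
  shows "uf_boundary n (extend_to_sums (map f) c) = extend_to_sums (map f) (uf_boundary n c)"
proof (cases n)
  case 0
  then show ?thesis by (simp add: uf_boundary_def extend_to_sums_def fun_eq_iff)
next
  case (Suc m)
  note map = controlled_map[OF f]
  have c': "c \<in> uf_chains (Suc m) X" using c Suc by simp
  have face: "extend_to_sums (map f) (extend_to_sums (face i) c) = extend_to_sums (face i) (extend_to_sums (map f) c)"
    if "i \<le> n" for i
  proof -
    have i: "i \<le> Suc m" using that Suc by simp
    have "map f \<circ> face i = face i \<circ> map f"
      by (auto simp: face_def take_map drop_map)
    then show ?thesis
      using extend_to_sums_comp[OF X controlled_face[OF i] map c']
        extend_to_sums_comp[OF X map controlled_face[OF i] c'] by simp
  qed
  have chain: "extend_to_sums (face i) c \<in> uf_chains m X" if "i \<in> {..n}" for i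
    using extend_to_sums_chain[OF X controlled_face c'] that Suc by simp
  have "extend_to_sums (map f) (\<lambda>x. \<Sum>i\<le>n. (-1) ^ i * extend_to_sums (face i) c x)
      = (\<lambda>y. \<Sum>i\<le>n. (-1) ^ i * extend_to_sums (map f) (extend_to_sums (face i) c) y)"
    by (rule extend_to_sums_sum[OF X map _ chain]) auto
  then show ?thesis
    using Suc face by (simp add: uf_boundary_def)
qed

section \<open>The prism homotopy\<close>

text \<open>The simplex \<open>(x\<^sub>0, \<dots>, x\<^sub>j, f x\<^sub>j, \<dots>, f x\<^sub>n)\<close> of the prism between a tuple and its image under \<open>f\<close>.\<close>

definition prism :: "('a \<Rightarrow> 'a) \<Rightarrow> nat \<Rightarrow> 'a list \<Rightarrow> 'a list" where
  "prism f j x = take (Suc j) x @ map f (drop j x)"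

lemma controlled_prism:
  assumes f: "f \<in> mspace X \<rightarrow> mspace X" "\<And>x. x \<in> mspace X \<Longrightarrow> mdist X (f x) x \<le> D" and j: "j \<le> n"
  shows "controlled X n (Suc n) (prism f j)"
  unfolding controlled_def
proof (intro exI[of _ "\<bar>D\<bar>"] ballI conjI)
  fix x assume x: "x \<in> uf_tuples n X"
  have sub: "set (prism f j x) \<subseteq> set x \<union> f ` set x"
    using set_take_subset[of "Suc j" x] set_drop_subset[of j x] by (auto simp: prism_def)
  moreover have "f ` set x \<subseteq> mspace X"
    using x f(1) by (auto simp: uf_tuples_def)
  moreover have "length (prism f j x) = Suc (Suc n)"
    using x j by (simp add: uf_tuples_def prism_def)
  ultimately show "prism f j x \<in> uf_tuples (Suc n) X"
    using x by (auto simp: uf_tuples_def)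
  fix p assume "p \<in> set (prism f j x)"
  then consider "p \<in> set x" | q where "q \<in> set x" "p = f q"
    using sub by blast
  then show "\<exists>q\<in>set x. mdist X p q \<le> \<bar>D\<bar>"
  proof cases
    case 1
    then show ?thesis using x by (intro bexI[of _ p]) (auto simp: uf_tuples_def subset_iff mdist_self)
  next
    case 2
    then have "mdist X p q \<le> D" using x f(2) by (auto simp: uf_tuples_def)
    then show ?thesis using 2 by (intro bexI[of _ q]) auto
  qed
qed

lemma face_Cons [simp]:
  "face 0 (a # x) = x" "face (Suc j) (a # x) = a # face j x"
  by (simp_all add: face_def)

lemma prism_Cons [simp]:
  "prism f 0 (a # x) = a # f a # map f x" "prism f (Suc j) (a # x) = a # prism f j x"
  by (simp_all add: prism_def)

lemma face_Nil [simp]: "face j [] = []" and prism_Nil [simp]: "prism f j [] = []"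
  by (simp_all add: face_def prism_def)

lemma face_map: "face j (map f x) = map f (face j x)"
  by (simp add: face_def take_map drop_map)

lemma face_prism_less: "i < j \<Longrightarrow> face i (prism f j x) = prism f (j - 1) (face i x)"
proof (induction x arbitrary: i j)
  case (Cons a x)
  then obtain j' where j': "j = Suc j'" by (cases j) auto
  show ?case
  proof (cases i)
    case (Suc i')
    then obtain j'' where "j' = Suc j''" using Cons.prems j' by (cases j') auto
    then show ?thesis using Suc Cons.prems Cons.IH[of i' j'] j' by simp
  qed (simp add: j')
qed simp

lemma face_prism_greater: "Suc j < i \<Longrightarrow> face i (prism f j x) = prism f j (face (i - 1) x)"
proof (induction x arbitrary: i j)
  case (Cons a x)
  then have "i = Suc (Suc (i - 2))" by arith
  then obtain i' where i': "i = Suc (Suc i')" by blast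
  show ?case
  proof (cases j)
    case (Suc j')
    then show ?thesis using Cons.prems Cons.IH[of j' "Suc i'"] i' by simp
  qed (simp add: i' face_map)
qed simp

text \<open>The two inner faces. The second face of the prism simplex \<open>j\<close> agrees with the first face of the
  prism simplex \<open>j + 1\<close>, which is why they cancel in the alternating sum.\<close>

lemma face_prism_eq:
  assumes "j < length x"
  shows "face j (prism f j x) = take j x @ map f (drop j x)"
    and "face (Suc j) (prism f j x) = take (Suc j) x @ map f (drop (Suc j) x)"
proof -
  have "face j (prism f j x) = take j x @ map f (drop j x) \<and>
      face (Suc j) (prism f j x) = take (Suc j) x @ map f (drop (Suc j) x)"
    using assms
  proof (induction x arbitrary: j)
    case (Cons a x)
    then show ?case by (cases j) auto
  qed simp
  then show "face j (prism f j x) = take j x @ map f (drop j x)"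
    and "face (Suc j) (prism f j x) = take (Suc j) x @ map f (drop (Suc j) x)"
    by blast+
qed

text \<open>The combinatorial core of the prism identity. Here \<open>a i j\<close> stands for the contribution of face \<open>i\<close> of
  prism \<open>j\<close>, \<open>b i j\<close> for that of prism \<open>j\<close> over face \<open>i\<close>, and \<open>q j\<close> for the common value of two
  adjacent inner faces. The inner faces telescope; the outer ones, on both sides of the diagonal,
  pair off with the terms of \<open>b\<close>, with a change of sign because one of the two indices drops by one.\<close>

lemma alternating_prism_sum:
  fixes a b :: "nat \<Rightarrow> nat \<Rightarrow> real" and q :: "nat \<Rightarrow> real"
  assumes less: "\<And>i j. i < j \<Longrightarrow> j \<le> n \<Longrightarrow> a i j = b i (j - 1)"
    and greater: "\<And>i j. Suc j < i \<Longrightarrow> i \<le> Suc n \<Longrightarrow> a i j = b (i - 1) j"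
    and eq: "\<And>j. j \<le> n \<Longrightarrow> a j j = q j" "\<And>j. j \<le> n \<Longrightarrow> a (Suc j) j = q (Suc j)"
  shows "(\<Sum>i\<le>Suc n. \<Sum>j\<le>n. (-1) ^ i * (-1) ^ j * a i j) =
    q 0 - q (Suc n) - (\<Sum>j<n. \<Sum>i\<le>n. (-1) ^ j * (-1) ^ i * b i j)"
proof -
  \<comment> \<open>The square of index pairs is cut into the part \<open>L\<close> with face index below the prism index, the part \<open>G\<close> with face index above its successor, and the two diagonals \<open>E\<close> and \<open>E'\<close> of inner faces.\<close>
  define s where "s = (\<lambda>(i, j). (-1) ^ i * (-1) ^ j * a i j :: real)"
  define t where "t = (\<lambda>(i, j). (-1) ^ i * (-1) ^ j * b i j :: real)"
  define L where "L = {(i, j). i < j \<and> j \<le> n}"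
  define G where "G = {(i, j). Suc j < i \<and> i \<le> Suc n}"
  define E where "E = (\<lambda>j. (j, j)) ` {..n}"
  define E' where "E' = (\<lambda>j. (Suc j, j)) ` {..n}"
  define T where "T = {(i, j). i \<le> j \<and> j < n}"
  define T' where "T' = {(i, j). j < i \<and> i \<le> n}"
  have split: "{..Suc n} \<times> {..n} = (L \<union> G) \<union> (E \<union> E')"
    unfolding L_def G_def E_def E'_def by (auto simp: image_iff)
  have "finite ((L \<union> G) \<union> (E \<union> E'))"
    unfolding split[symmetric] by simp
  then have fin: "finite L" "finite G" "finite E" "finite E'" by simp_all
  have disj: "(L \<union> G) \<inter> (E \<union> E') = {}" "L \<inter> G = {}" "E \<inter> E' = {}"
    unfolding L_def G_def E_def E'_def by auto
  have split': "{..n} \<times> {..<n} = T \<union> T'"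
    unfolding T_def T'_def by auto
  have "finite (T \<union> T')"
    unfolding split'[symmetric] by simp
  then have fin': "finite T" "finite T'" by simp_all
  have disj': "T \<inter> T' = {}"
    unfolding T_def T'_def by auto
  have s_less: "s (i, j) = - t (i, j - 1)" if "i < j" "j \<le> n" for i j
    using less[OF that] that(1) by (cases j) (simp_all add: s_def t_def)
  have "sum s L = (\<Sum>p\<in>T. - t p)"
    by (rule sum.reindex_bij_witness[of _ "\<lambda>(i, j). (i, Suc j)" "\<lambda>(i, j). (i, j - 1)"])
      (auto simp: L_def T_def s_less)
  moreover have s_greater: "s (i, j) = - t (i - 1, j)" if "Suc j < i" "i \<le> Suc n" for i j
    using greater[OF that] that(1) by (cases i) (simp_all add: s_def t_def)
  have "sum s G = (\<Sum>p\<in>T'. - t p)"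
    by (rule sum.reindex_bij_witness[of _ "\<lambda>(i, j). (Suc i, j)" "\<lambda>(i, j). (i - 1, j)"])
      (auto simp: G_def T'_def s_greater)
  ultimately have off: "sum s L + sum s G = - sum t ({..n} \<times> {..<n})"
    unfolding split' using fin' disj' by (simp add: sum_negf sum.union_disjoint)
  have sq: "(-1) ^ j * (-1) ^ j = (1::real)" for j :: nat
    by (simp add: power_mult_distrib[symmetric])
  have "sum s E = (\<Sum>j\<le>n. q j)"
    unfolding E_def s_def by (subst sum.reindex) (auto simp: inj_on_def eq sq)
  moreover have "sum s E' = - (\<Sum>j\<le>n. q (Suc j))"
    unfolding E'_def s_def by (subst sum.reindex) (auto simp: inj_on_def eq sq sum_negf)
  moreover have "(\<Sum>j\<le>n. q j) - (\<Sum>j\<le>n. q (Suc j)) = q 0 - q (Suc n)"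
    unfolding sum_subtractf[symmetric] by (rule sum_telescope)
  ultimately have diag: "sum s E + sum s E' = q 0 - q (Suc n)" by simp
  have "(\<Sum>i\<le>Suc n. \<Sum>j\<le>n. (-1) ^ i * (-1) ^ j * a i j) = sum s ({..Suc n} \<times> {..n})"
    unfolding s_def by (rule sum.cartesian_product)
  also have "\<dots> = (sum s L + sum s G) + (sum s E + sum s E')"
    using fin disj unfolding split by (simp add: sum.union_disjoint)
  also have "\<dots> = q 0 - q (Suc n) - sum t ({..n} \<times> {..<n})"
    unfolding off diag by simp
  also have "sum t ({..n} \<times> {..<n}) = (\<Sum>i\<le>n. \<Sum>j<n. (-1) ^ i * (-1) ^ j * b i j)"
    unfolding t_def by (rule sum.cartesian_product[symmetric])
  also have "\<dots> = (\<Sum>j<n. \<Sum>i\<le>n. (-1) ^ i * (-1) ^ j * b i j)"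
    by (rule sum.swap)
  also have "\<dots> = (\<Sum>j<n. \<Sum>i\<le>n. (-1) ^ j * (-1) ^ i * b i j)"
    by (simp only: mult.commute[of "(-1) ^ _" "(-1) ^ _"])
  finally show ?thesis .
qed

text \<open>The chain homotopy is the alternating sum of the prism simplices. For a cycle the terms that involve
  faces of \<open>c\<close> vanish, so its boundary is exactly the difference of \<open>c\<close> and its push-forward.\<close>

lemma prism_homotopy:
  assumes X: "UDBG X" and f: "f \<in> mspace X \<rightarrow> mspace X" "\<And>x. x \<in> mspace X \<Longrightarrow> mdist X (f x) x \<le> D"
    and c: "c \<in> uf_cycles n X"
  shows "(\<lambda>x. extend_to_sums (map f) c x - c x) \<in> uf_boundaries n X"
proof -
  have c: "c \<in> uf_chains n X" and cycle: "uf_boundary n c = (\<lambda>_. 0)"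
    using c by (auto simp: uf_cycles_def)
  have prism: "controlled X m (Suc m) (prism f j)" if "j \<le> m" for m j
    using f that by (rule controlled_prism)
  have chain: "extend_to_sums (prism f j) c \<in> uf_chains (Suc n) X" if "j \<in> {..n}" for j
    using extend_to_sums_chain[OF X prism c] that by simp
  define h where "h = (\<lambda>x. \<Sum>j\<le>n. (-1) ^ j * extend_to_sums (prism f j) c x)"
  have h: "h \<in> uf_chains (Suc n) X"
    unfolding h_def by (rule uf_chains_sum[OF _ chain]) auto
  have face_h: "extend_to_sums (face i) h y = (\<Sum>j\<le>n. (-1) ^ j * extend_to_sums (face i \<circ> prism f j) c y)"
    if i: "i \<le> Suc n" for i y
  proof -
    have "extend_to_sums (face i) h y
        = (\<Sum>j\<le>n. (-1) ^ j * extend_to_sums (face i) (extend_to_sums (prism f j) c) y)"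
      unfolding h_def by (rule fun_cong[OF extend_to_sums_sum[OF X controlled_face[OF i] _ chain]]) auto
    also have "\<dots> = (\<Sum>j\<le>n. (-1) ^ j * extend_to_sums (face i \<circ> prism f j) c y)"
      by (intro sum.cong refl arg_cong2[where f = "(*)"] fun_cong[OF extend_to_sums_comp[OF X prism controlled_face[OF i] c]])
        auto
    finally show ?thesis .
  qed
  have "uf_boundary (Suc n) h y = extend_to_sums (map f) c y - c y" for y
  proof -
    define a where "a = (\<lambda>i j. extend_to_sums (face i \<circ> prism f j) c y)"
    define b where "b = (\<lambda>i j. extend_to_sums (prism f j \<circ> face i) c y)"
    define q where "q = (\<lambda>j. extend_to_sums (\<lambda>x. take j x @ map f (drop j x)) c y)"
    note cong = fun_cong[OF extend_to_sums_cong[OF c]]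
    have "uf_boundary (Suc n) h y = (\<Sum>i\<le>Suc n. \<Sum>j\<le>n. (-1) ^ i * (-1) ^ j * a i j)"
      unfolding a_def uf_boundary_def by (simp add: face_h sum_distrib_left mult.assoc del: sum.atMost_Suc)
    also have "\<dots> = q 0 - q (Suc n) - (\<Sum>j<n. \<Sum>i\<le>n. (-1) ^ j * (-1) ^ i * b i j)"
    proof (rule alternating_prism_sum)
      fix i j :: nat assume "i < j"
      then show "a i j = b i (j - 1)"
        unfolding a_def b_def by (intro cong) (simp add: face_prism_less)
    next
      fix i j :: nat assume "Suc j < i"
      then show "a i j = b (i - 1) j"
        unfolding a_def b_def by (intro cong) (simp add: face_prism_greater)
    next
      fix j assume "j \<le> n"
      then show "a j j = q j" "a (Suc j) j = q (Suc j)"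
        unfolding a_def q_def by (intro cong; simp add: face_prism_eq uf_tuples_def)+
    qed
    also have "(\<Sum>j<n. \<Sum>i\<le>n. (-1) ^ j * (-1) ^ i * b i j) = 0"
    proof (cases n)
      case (Suc m)
      have c': "c \<in> uf_chains (Suc m) X" using c Suc by simp
      have face: "extend_to_sums (face i) c \<in> uf_chains m X" if "i \<in> {..n}" for i
        using extend_to_sums_chain[OF X controlled_face c'] that Suc by simp
      have "(\<Sum>i\<le>n. (-1) ^ i * b i j) = 0" if "j < n" for j
      proof -
        have j: "j \<le> m" using that Suc by simp
        have "(\<Sum>i\<le>n. (-1) ^ i * b i j)
            = (\<Sum>i\<le>n. (-1) ^ i * extend_to_sums (prism f j) (extend_to_sums (face i) c) y)"
          unfolding b_def using Suc
          by (intro sum.cong refl arg_cong2[where f = "(*)"]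
              fun_cong[OF extend_to_sums_comp[OF X controlled_face prism[OF j] c', symmetric]]) auto
        also have "\<dots> = extend_to_sums (prism f j) (\<lambda>x. \<Sum>i\<le>n. (-1) ^ i * extend_to_sums (face i) c x) y"
          by (rule fun_cong[OF extend_to_sums_sum[OF X prism[OF j] _ face, symmetric]]) auto
        also have "(\<lambda>x. \<Sum>i\<le>n. (-1) ^ i * extend_to_sums (face i) c x) = (\<lambda>_. 0)"
          using cycle Suc by (simp add: uf_boundary_def)
        also have "extend_to_sums (prism f j) (\<lambda>_. 0) y = 0"
          by (simp add: extend_to_sums_def)
        finally show ?thesis .
      qed
      then show ?thesis by (simp add: mult.assoc sum_distrib_left[symmetric])
    qed simp
    also have "q 0 = extend_to_sums (map f) c y"
      unfolding q_def by simp
    also have "q (Suc n) = extend_to_sums (\<lambda>x. x) c y"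
      unfolding q_def by (intro cong) (simp add: uf_tuples_def)
    finally show ?thesis by (simp add: extend_to_sums_id)
  qed
  then have "(\<lambda>x. extend_to_sums (map f) c x - c x) = uf_boundary (Suc n) h" by auto
  then show ?thesis
    unfolding uf_boundaries_def using h by auto
qed

section \<open>The module structure of uniformly finite homology\<close>

lemma uf_cycles_sum:
  assumes X: "UDBG X" and J: "finite J" and c: "\<And>j. j \<in> J \<Longrightarrow> c j \<in> uf_cycles n X"
  shows "(\<lambda>x. \<Sum>j\<in>J. w j * c j x) \<in> uf_cycles n X"
proof -
  have chain: "c j \<in> uf_chains n X" if "j \<in> J" for j
    using c[OF that] by (simp add: uf_cycles_def)
  have "uf_boundary n (\<lambda>x. \<Sum>j\<in>J. w j * c j x) = (\<lambda>y. \<Sum>j\<in>J. w j * uf_boundary n (c j) y)"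
    by (rule uf_boundary_sum[OF X J chain])
  also have "\<dots> = (\<lambda>_. 0)"
    using c by (auto simp: uf_cycles_def)
  finally show ?thesis
    unfolding uf_cycles_def using uf_chains_sum[of J c n X w, OF J chain] by simp
qed

lemma uf_boundaries_sum:
  assumes X: "UDBG X" and J: "finite J" and c: "\<And>j. j \<in> J \<Longrightarrow> c j \<in> uf_boundaries n X"
  shows "(\<lambda>x. \<Sum>j\<in>J. w j * c j x) \<in> uf_boundaries n X"
proof -
  have "\<forall>j\<in>J. \<exists>b. b \<in> uf_chains (Suc n) X \<and> c j = uf_boundary (Suc n) b"
    using c unfolding uf_boundaries_def by blast
  then obtain b where b: "\<And>j. j \<in> J \<Longrightarrow> b j \<in> uf_chains (Suc n) X"
    and cb: "\<And>j. j \<in> J \<Longrightarrow> c j = uf_boundary (Suc n) (b j)"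
    by (auto dest!: bchoice)
  have "(\<lambda>x. \<Sum>j\<in>J. w j * c j x) = (\<lambda>x. \<Sum>j\<in>J. w j * uf_boundary (Suc n) (b j) x)"
    by (simp add: cb)
  also have "\<dots> = uf_boundary (Suc n) (\<lambda>x. \<Sum>j\<in>J. w j * b j x)"
    by (rule uf_boundary_sum[OF X J b, symmetric])
  finally show ?thesis
    unfolding uf_boundaries_def using uf_chains_sum[of J b "Suc n" X w, OF J b] by blast
qed

text \<open>Combinations of two chains are sums indexed by the two truth values.\<close>

lemma uf_cycles_lincomb:
  assumes "UDBG X" "c \<in> uf_cycles n X" "d \<in> uf_cycles n X"
  shows "(\<lambda>x. a * c x + b * d x) \<in> uf_cycles n X"
  using uf_cycles_sum[of X UNIV "\<lambda>t. if t then c else d" n "\<lambda>t. if t then a else b"] assms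
  by (simp add: UNIV_bool add.commute)

lemma uf_boundaries_lincomb:
  assumes "UDBG X" "c \<in> uf_boundaries n X" "d \<in> uf_boundaries n X"
  shows "(\<lambda>x. a * c x + b * d x) \<in> uf_boundaries n X"
  using uf_boundaries_sum[of X UNIV "\<lambda>t. if t then c else d" n "\<lambda>t. if t then a else b"] assms
  by (simp add: UNIV_bool add.commute)

lemma zero_in_uf_boundaries: "UDBG X \<Longrightarrow> (\<lambda>_. 0) \<in> uf_boundaries n X"
  using uf_boundaries_sum[of X "{}"] by simp

text \<open>All three properties say that the boundaries are closed under linear combinations.\<close>

lemma equiv_homologous:
  assumes X: "UDBG X"
  shows "equiv (uf_cycles n X) (homologous n X)"
proof (rule equivI)
  show "homologous n X \<subseteq> uf_cycles n X \<times> uf_cycles n X"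
    by (auto simp: homologous_def)
  show "refl_on (uf_cycles n X) (homologous n X)"
    by (auto simp: refl_on_def homologous_def zero_in_uf_boundaries[OF X])
  show "sym (homologous n X)"
  proof (rule symI)
    fix c d assume "(c, d) \<in> homologous n X"
    then show "(d, c) \<in> homologous n X"
      using uf_boundaries_lincomb[OF X, of "\<lambda>x. c x - d x" n "\<lambda>x. c x - d x" "-1" 0]
      by (auto simp: homologous_def)
  qed
  show "trans (homologous n X)"
  proof (rule transI)
    fix c d e assume "(c, d) \<in> homologous n X" "(d, e) \<in> homologous n X"
    then show "(c, e) \<in> homologous n X"
      using uf_boundaries_lincomb[OF X, of "\<lambda>x. c x - d x" n "\<lambda>x. d x - e x" 1 1]
      by (auto simp: homologous_def)
  qed
qed

lemma uf_class_eq_iff: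
  assumes "UDBG X" "c \<in> uf_cycles n X" "d \<in> uf_cycles n X"
  shows "uf_class n X c = uf_class n X d \<longleftrightarrow> (\<lambda>x. c x - d x) \<in> uf_boundaries n X"
  unfolding uf_class_def using eq_equiv_class_iff[OF equiv_homologous assms(2,3)] assms
  by (auto simp: homologous_def)

lemma uf_homology_carrierE:
  assumes "\<alpha> \<in> carrier (uf_homology n X)"
  obtains c where "c \<in> uf_cycles n X" "\<alpha> = uf_class n X c"
  using assms by (auto simp: uf_homology_def uf_class_def elim: quotientE)

lemma uf_class_in_carrier: "c \<in> uf_cycles n X \<Longrightarrow> uf_class n X c \<in> carrier (uf_homology n X)"
  by (simp add: uf_homology_def uf_class_def quotientI)

lemma uf_homology_add:
  assumes X: "UDBG X" and c: "c \<in> uf_cycles n X" and d: "d \<in> uf_cycles n X"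
  shows "uf_class n X c \<oplus>\<^bsub>uf_homology n X\<^esub> uf_class n X d = uf_class n X (\<lambda>x. c x + d x)"
proof -
  have "congruent2 (homologous n X) (homologous n X) (\<lambda>c d. uf_class n X (\<lambda>x. c x + d x))"
  proof (rule congruent2I')
    fix c c' d d'
    assume h: "(c, c') \<in> homologous n X" "(d, d') \<in> homologous n X"
    then have cyc: "(\<lambda>x. c x + d x) \<in> uf_cycles n X" "(\<lambda>x. c' x + d' x) \<in> uf_cycles n X"
      using uf_cycles_lincomb[OF X, of _ n _ 1 1] by (auto simp: homologous_def)
    have "(\<lambda>x. c x + d x - (c' x + d' x)) \<in> uf_boundaries n X"
      using uf_boundaries_lincomb[OF X, of "\<lambda>x. c x - c' x" n "\<lambda>x. d x - d' x" 1 1] h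
      by (auto simp: homologous_def algebra_simps)
    then show "uf_class n X (\<lambda>x. c x + d x) = uf_class n X (\<lambda>x. c' x + d' x)"
      using uf_class_eq_iff[OF X cyc] by simp
  qed
  from UN_equiv_class2[OF equiv_homologous[OF X] equiv_homologous[OF X] this c d]
  show ?thesis by (simp add: uf_homology_def uf_class_def)
qed

lemma uf_homology_smult:
  assumes X: "UDBG X" and c: "c \<in> uf_cycles n X"
  shows "r \<odot>\<^bsub>uf_homology n X\<^esub> uf_class n X c = uf_class n X (\<lambda>x. r * c x)"
proof -
  have "congruent (homologous n X) (\<lambda>c. uf_class n X (\<lambda>x. r * c x))"
  proof (rule congruentI)
    fix c c' assume h: "(c, c') \<in> homologous n X"
    then have cyc: "(\<lambda>x. r * c x) \<in> uf_cycles n X" "(\<lambda>x. r * c' x) \<in> uf_cycles n X"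
      using uf_cycles_lincomb[OF X, of _ n _ r 0] by (auto simp: homologous_def)
    have "(\<lambda>x. r * c x - r * c' x) \<in> uf_boundaries n X"
      using uf_boundaries_lincomb[OF X, of "\<lambda>x. c x - c' x" n "\<lambda>x. c x - c' x" r 0] h
      by (auto simp: homologous_def algebra_simps)
    then show "uf_class n X (\<lambda>x. r * c x) = uf_class n X (\<lambda>x. r * c' x)"
      using uf_class_eq_iff[OF X cyc] by simp
  qed
  from UN_equiv_class[OF equiv_homologous[OF X] this c]
  show ?thesis by (simp add: uf_homology_def uf_class_def)
qed

section \<open>Passing to a subspace\<close>

text \<open>Together with the inclusion of \<open>S\<close> this is a coarse equivalence in the most economical form: one
  composite is the identity, the other one has bounded displacement.\<close>

definition coarse_retraction :: "'a metric \<Rightarrow> 'a set \<Rightarrow> ('a \<Rightarrow> 'a) \<Rightarrow> bool" where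
  "coarse_retraction X S r \<longleftrightarrow>
     r \<in> mspace X \<rightarrow> S \<and> (\<forall>x\<in>S. r x = x) \<and> (\<exists>D. \<forall>x\<in>mspace X. mdist X (r x) x \<le> D)"

lemma UDBG_submetric:
  assumes X: "UDBG X"
  shows "UDBG (submetric X S)"
  unfolding UDBG_def
proof (intro conjI allI impI)
  show "\<exists>\<epsilon>>0. \<forall>x\<in>mspace (submetric X S). \<forall>y\<in>mspace (submetric X S).
      mdist (submetric X S) x y < \<epsilon> \<longleftrightarrow> x = y"
  proof -
    obtain \<epsilon> where "\<epsilon> > 0" "\<forall>x\<in>mspace X. \<forall>y\<in>mspace X. mdist X x y < \<epsilon> \<longleftrightarrow> x = y"
      using X[unfolded UDBG_def, THEN conjunct1] by (elim exE conjE)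
    then show ?thesis by (intro exI[of _ \<epsilon>]) simp
  qed
next
  fix r :: real assume r: "r > 0"
  obtain K where K: "K > 0" "\<And>p. p \<in> mspace X \<Longrightarrow> finite (mball_of X p r) \<and> real (card (mball_of X p r)) < K"
    using X[unfolded UDBG_def, THEN conjunct2, rule_format, OF r] by (elim exE conjE) blast
  have "finite (mball_of (submetric X S) p r) \<and> real (card (mball_of (submetric X S) p r)) < K"
    if p: "p \<in> mspace (submetric X S)" for p
  proof -
    have sub: "mball_of (submetric X S) p r \<subseteq> mball_of X p r"
      by (auto simp: in_mball_of)
    have fin: "finite (mball_of X p r)" and card: "real (card (mball_of X p r)) < K"
      using K(2)[of p] p by auto
    have "real (card (mball_of (submetric X S) p r)) \<le> real (card (mball_of X p r))"
      using card_mono[OF fin sub] by (rule of_nat_mono)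
    then show ?thesis using finite_subset[OF sub fin] card by simp
  qed
  then show "\<exists>K::real. K > 0 \<and> (\<forall>x\<in>mspace (submetric X S).
      finite (mball_of (submetric X S) x r) \<and> real (card (mball_of (submetric X S) x r)) < K)"
    using K(1) by (intro exI[of _ K]) simp
qed

lemma uf_chains_submetric:
  "c \<in> uf_chains n (submetric X S) \<longleftrightarrow> c \<in> uf_chains n X \<and> (\<forall>x. c x \<noteq> 0 \<longrightarrow> set x \<subseteq> S)"
  unfolding uf_chains_iff uf_tuples_def by (simp add: subset_iff) blast

lemma uf_cycles_submetric:
  "c \<in> uf_cycles n (submetric X S) \<longleftrightarrow> c \<in> uf_cycles n X \<and> (\<forall>x. c x \<noteq> 0 \<longrightarrow> set x \<subseteq> S)"
  unfolding uf_cycles_def mem_Collect_eq uf_chains_submetric by blast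

lemma coarse_retraction_bounded:
  assumes "S \<subseteq> mspace X" "coarse_retraction X S r"
  obtains D where "r \<in> mspace X \<rightarrow> mspace X" "\<And>x. x \<in> mspace X \<Longrightarrow> mdist X (r x) x \<le> D"
  using assms unfolding coarse_retraction_def by blast

lemma retraction_chain:
  assumes X: "UDBG X" and S: "S \<subseteq> mspace X" and r: "coarse_retraction X S r" and c: "c \<in> uf_chains n X"
  shows "extend_to_sums (map r) c \<in> uf_chains n (submetric X S)"
  unfolding uf_chains_submetric
proof (intro conjI allI impI)
  obtain D where D: "r \<in> mspace X \<rightarrow> mspace X" "\<And>x. x \<in> mspace X \<Longrightarrow> mdist X (r x) x \<le> D"
    by (rule coarse_retraction_bounded[OF S r]) blast
  have "controlled X n n (map r)" using D by (rule controlled_map)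
  from extend_to_sums_chain[OF X this c] show "extend_to_sums (map r) c \<in> uf_chains n X" .
  fix y assume "extend_to_sums (map r) c y \<noteq> 0"
  then obtain x where x: "c x \<noteq> 0" "map r x = y" by (rule extend_to_sums_nonzero)
  then have "set x \<subseteq> mspace X" using c by (auto simp: uf_chains_iff uf_tuples_def)
  then show "set y \<subseteq> S" using x(2) r by (fastforce simp: coarse_retraction_def)
qed

lemma retraction_cycle:
  assumes X: "UDBG X" and S: "S \<subseteq> mspace X" and r: "coarse_retraction X S r" and c: "c \<in> uf_cycles n X"
  shows "extend_to_sums (map r) c \<in> uf_cycles n (submetric X S)"
proof -
  obtain D where D: "r \<in> mspace X \<rightarrow> mspace X" "\<And>x. x \<in> mspace X \<Longrightarrow> mdist X (r x) x \<le> D"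
    by (rule coarse_retraction_bounded[OF S r]) blast
  have c: "c \<in> uf_chains n X" and cycle: "uf_boundary n c = (\<lambda>_. 0)"
    using c by (auto simp: uf_cycles_def)
  have "uf_boundary n (extend_to_sums (map r) c) = extend_to_sums (map r) (uf_boundary n c)"
    using X D c by (rule uf_boundary_extend_map)
  also have "\<dots> = (\<lambda>_. 0)" unfolding cycle by (simp add: extend_to_sums_def fun_eq_iff)
  finally show ?thesis using retraction_chain[OF X S r c] by (simp add: uf_cycles_def)
qed

lemma retraction_fixes_chain:
  assumes r: "coarse_retraction X S r" and c: "c \<in> uf_chains n (submetric X S)"
  shows "extend_to_sums (map r) c = c"
proof -
  have "extend_to_sums (map r) c = extend_to_sums (\<lambda>x. x) c"
    using c by (rule extend_to_sums_cong)
      (use r in \<open>auto simp: coarse_retraction_def uf_tuples_def intro!: map_idI\<close>)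
  then show ?thesis by (simp add: extend_to_sums_id)
qed

text \<open>A chain of \<open>S\<close> that bounds in \<open>X\<close> also bounds in \<open>S\<close>: the retraction fixes it and moves a
  bounding chain into \<open>S\<close>. In homology this is injectivity of the inclusion.\<close>

lemma uf_boundaries_submetric:
  assumes X: "UDBG X" and S: "S \<subseteq> mspace X" and r: "coarse_retraction X S r"
    and c: "c \<in> uf_chains n (submetric X S)"
  shows "c \<in> uf_boundaries n (submetric X S) \<longleftrightarrow> c \<in> uf_boundaries n X"
proof
  show "c \<in> uf_boundaries n X" if "c \<in> uf_boundaries n (submetric X S)"
    using that unfolding uf_boundaries_def by (auto simp: uf_chains_submetric)
next
  assume "c \<in> uf_boundaries n X"
  then obtain b where b: "b \<in> uf_chains (Suc n) X" "c = uf_boundary (Suc n) b"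
    by (auto simp: uf_boundaries_def)
  obtain D where D: "r \<in> mspace X \<rightarrow> mspace X" "\<And>x. x \<in> mspace X \<Longrightarrow> mdist X (r x) x \<le> D"
    by (rule coarse_retraction_bounded[OF S r]) blast
  have "c = extend_to_sums (map r) (uf_boundary (Suc n) b)"
    using retraction_fixes_chain[OF r c] b(2) by simp
  also have "\<dots> = uf_boundary (Suc n) (extend_to_sums (map r) b)"
    using uf_boundary_extend_map[OF X D(1) _ b(1)] D(2) by metis
  finally show "c \<in> uf_boundaries n (submetric X S)"
    unfolding uf_boundaries_def using retraction_chain[OF X S r b(1)] by blast
qed

lemma uf_class_submetric_eq_iff:
  assumes X: "UDBG X" and S: "S \<subseteq> mspace X" and r: "coarse_retraction X S r"
    and c: "c \<in> uf_cycles n (submetric X S)" and d: "d \<in> uf_cycles n (submetric X S)"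
  shows "uf_class n (submetric X S) c = uf_class n (submetric X S) d \<longleftrightarrow> uf_class n X c = uf_class n X d"
proof -
  have "(\<lambda>x. c x - d x) \<in> uf_cycles n (submetric X S)"
    using uf_cycles_lincomb[OF UDBG_submetric[OF X] c d, of 1 "-1"] by simp
  then have "(\<lambda>x. c x - d x) \<in> uf_chains n (submetric X S)"
    by (simp add: uf_cycles_def)
  moreover have "c \<in> uf_cycles n X" "d \<in> uf_cycles n X"
    using c d by (simp_all add: uf_cycles_submetric)
  ultimately show ?thesis
    using uf_class_eq_iff[OF UDBG_submetric[OF X] c d] uf_class_eq_iff[OF X]
      uf_boundaries_submetric[OF X S r] by simp
qed

text \<open>A chain of \<open>S\<close> is also a chain of \<open>X\<close>, and the inclusion does not change it as a function on tuples.\<close>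

lemma uf_induced_inclusion:
  assumes X: "UDBG X" and c: "c \<in> uf_cycles n (submetric X S)"
  shows "uf_induced n X (\<lambda>x. x) (uf_class n (submetric X S) c) = uf_class n X c"
proof -
  have map: "map (\<lambda>x. x) = (\<lambda>x :: 'a list. x)" by (simp add: fun_eq_iff)
  have "congruent (homologous n (submetric X S)) (uf_class n X)"
  proof (rule congruentI)
    fix c d assume h: "(c, d) \<in> homologous n (submetric X S)"
    then have "c \<in> uf_cycles n X" "d \<in> uf_cycles n X" "(\<lambda>x. c x - d x) \<in> uf_boundaries n X"
      by (auto simp: homologous_def uf_cycles_submetric uf_boundaries_def uf_chains_submetric)
    then show "uf_class n X c = uf_class n X d" using uf_class_eq_iff[OF X] by simp
  qed
  from UN_equiv_class[OF equiv_homologous[OF UDBG_submetric[OF X]] this c]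
  show ?thesis by (simp add: uf_induced_def uf_class_def map extend_to_sums_id)
qed

text \<open>Injectivity comes from the retraction being the identity on chains of \<open>S\<close>, surjectivity from the
  prism homotopy between a cycle of \<open>X\<close> and its push-forward.\<close>

lemma inclusion_linear_isomorphism:
  assumes X: "UDBG X" and S: "S \<subseteq> mspace X" and r: "coarse_retraction X S r"
  shows "uf_induced n X (\<lambda>x. x) \<in> linear_isomorphisms (uf_homology n (submetric X S)) (uf_homology n X)"
proof -
  let ?Y = "submetric X S"
  let ?F = "uf_induced n X (\<lambda>x. x)"
  note Y = UDBG_submetric[OF X, of S]
  note F = uf_induced_inclusion[OF X]
  have cyc: "c \<in> uf_cycles n X" if "c \<in> uf_cycles n ?Y" for c
    using that by (simp add: uf_cycles_submetric)
  have add: "?F (\<alpha> \<oplus>\<^bsub>uf_homology n ?Y\<^esub> \<beta>) = ?F \<alpha> \<oplus>\<^bsub>uf_homology n X\<^esub> ?F \<beta>"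
    if ab: "\<alpha> \<in> carrier (uf_homology n ?Y)" "\<beta> \<in> carrier (uf_homology n ?Y)" for \<alpha> \<beta>
  proof -
    obtain c d where c: "c \<in> uf_cycles n ?Y" "\<alpha> = uf_class n ?Y c"
      and d: "d \<in> uf_cycles n ?Y" "\<beta> = uf_class n ?Y d"
      using ab by (elim uf_homology_carrierE)
    have "(\<lambda>x. c x + d x) \<in> uf_cycles n ?Y"
      using uf_cycles_lincomb[OF Y c(1) d(1), of 1 1] by simp
    then show ?thesis
      using c d cyc by (simp add: uf_homology_add[OF Y] uf_homology_add[OF X] F)
  qed
  have smult: "?F (s \<odot>\<^bsub>uf_homology n ?Y\<^esub> \<alpha>) = s \<odot>\<^bsub>uf_homology n X\<^esub> ?F \<alpha>"
    if a: "\<alpha> \<in> carrier (uf_homology n ?Y)" for s \<alpha>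
  proof -
    obtain c where c: "c \<in> uf_cycles n ?Y" "\<alpha> = uf_class n ?Y c"
      using a by (elim uf_homology_carrierE)
    have "(\<lambda>x. s * c x) \<in> uf_cycles n ?Y"
      using uf_cycles_lincomb[OF Y c(1) c(1), of s 0] by simp
    then show ?thesis
      using c cyc by (simp add: uf_homology_smult[OF Y] uf_homology_smult[OF X] F)
  qed
  have closed: "?F \<alpha> \<in> carrier (uf_homology n X)" if "\<alpha> \<in> carrier (uf_homology n ?Y)" for \<alpha>
    using that cyc by (elim uf_homology_carrierE) (simp add: F uf_class_in_carrier)
  have inj: "inj_on ?F (carrier (uf_homology n ?Y))"
  proof (rule inj_onI)
    fix \<alpha> \<beta> assume ab: "\<alpha> \<in> carrier (uf_homology n ?Y)" "\<beta> \<in> carrier (uf_homology n ?Y)"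
      and eq: "?F \<alpha> = ?F \<beta>"
    obtain c d where c: "c \<in> uf_cycles n ?Y" "\<alpha> = uf_class n ?Y c"
      and d: "d \<in> uf_cycles n ?Y" "\<beta> = uf_class n ?Y d"
      using ab by (elim uf_homology_carrierE)
    show "\<alpha> = \<beta>"
      using eq uf_class_submetric_eq_iff[OF X S r c(1) d(1)] unfolding c(2) d(2) F[OF c(1)] F[OF d(1)] by simp
  qed
  have surj: "\<beta> \<in> ?F ` carrier (uf_homology n ?Y)" if b: "\<beta> \<in> carrier (uf_homology n X)" for \<beta>
  proof -
    obtain c where c: "c \<in> uf_cycles n X" "\<beta> = uf_class n X c"
      using b by (elim uf_homology_carrierE)
    obtain D where D: "r \<in> mspace X \<rightarrow> mspace X" "\<And>x. x \<in> mspace X \<Longrightarrow> mdist X (r x) x \<le> D"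
      by (rule coarse_retraction_bounded[OF S r]) blast
    let ?c = "extend_to_sums (map r) c"
    have c': "?c \<in> uf_cycles n ?Y" using retraction_cycle[OF X S r c(1)] .
    have "(\<lambda>x. ?c x - c x) \<in> uf_boundaries n X"
      using X D c(1) by (rule prism_homotopy)
    then have "?F (uf_class n ?Y ?c) = \<beta>"
      unfolding c(2) F[OF c'] uf_class_eq_iff[OF X cyc[OF c'] c(1)] .
    then show ?thesis using uf_class_in_carrier[OF c'] by blast
  qed
  have "bij_betw ?F (carrier (uf_homology n ?Y)) (carrier (uf_homology n X))"
    unfolding bij_betw_def using inj closed surj by blast
  then show ?thesis
    unfolding linear_isomorphisms_def iso_def hom_def using add smult closed by simp
qed

section \<open>Dispersing families of retractions\<close>

text \<open>Injectivity in both arguments at once bounds two things: a fibre of one retraction contains at most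
  one point outside \<open>S\<close>, and a point of \<open>S\<close> is the target of such a point under at most one of the
  retractions.\<close>

definition dispersing_retractions :: "'a metric \<Rightarrow> 'a set \<Rightarrow> nat \<Rightarrow> (nat \<Rightarrow> 'a \<Rightarrow> 'a) \<Rightarrow> bool" where
  "dispersing_retractions X S N r \<longleftrightarrow>
     (\<forall>j<N. coarse_retraction X S (r j)) \<and> inj_on (\<lambda>(j, a). r j a) ({..<N} \<times> (mspace X - S))"

lemma card_map_fibre:
  assumes "\<And>b. finite {a \<in> M. r a = b} \<and> card {a \<in> M. r a = b} \<le> k"
  shows "finite {x. set x \<subseteq> M \<and> map r x = y} \<and> card {x. set x \<subseteq> M \<and> map r x = y} \<le> k ^ length y"
proof (induction y)
  case Nil
  have "{x. set x \<subseteq> M \<and> map r x = []} = {[]}" by auto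
  then show ?case by simp
next
  case (Cons b y)
  let ?A = "{a \<in> M. r a = b}" and ?B = "{x. set x \<subseteq> M \<and> map r x = y}"
  have eq: "{x. set x \<subseteq> M \<and> map r x = b # y} = (\<lambda>(a, x). a # x) ` (?A \<times> ?B)"
    by (auto simp: map_eq_Cons_conv)
  have fin: "finite (?A \<times> ?B)" using assms Cons.IH by simp
  have "card {x. set x \<subseteq> M \<and> map r x = b # y} \<le> card ?A * card ?B"
    unfolding eq card_cartesian_product[symmetric] by (rule card_image_le[OF fin])
  also have "\<dots> \<le> k * k ^ length y"
    using assms Cons.IH by (intro mult_mono) auto
  finally show ?case using fin unfolding eq by simp
qed

lemma uf_norm_upper: "c \<in> uf_chains n X \<Longrightarrow> \<bar>c x\<bar> \<le> uf_norm c"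
  unfolding uf_norm_def by (rule cSUP_upper) (auto simp: uf_chains_def)

lemma uf_norm_least: "(\<And>x. \<bar>c x\<bar> \<le> B) \<Longrightarrow> uf_norm c \<le> B"
  unfolding uf_norm_def by (rule cSUP_least) auto

text \<open>Call an index \<open>j\<close> bad for a tuple \<open>y\<close> if \<open>r j\<close> maps a point outside \<open>S\<close> to an entry of \<open>y\<close>. For the
  other indices the only tuple over \<open>y\<close> that can occur is \<open>y\<close> itself. For a bad index there are at
  most \<open>2 ^ Suc n\<close> tuples over \<open>y\<close>, as each entry has at most two preimages; and each of the \<open>Suc n\<close> entries
  makes at most one index bad.\<close>

lemma uf_norm_average:
  assumes r: "dispersing_retractions X S N r" and N: "N > 0" and c: "c \<in> uf_chains n X"
  shows "uf_norm (\<lambda>y. \<Sum>j<N. 1 / N * extend_to_sums (map (r j)) c y)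
    \<le> (1 + Suc n * 2 ^ Suc n / N) * uf_norm c"
proof (rule uf_norm_least)
  fix y
  let ?M = "mspace X" and ?B = "uf_norm c"
  have ret: "r j \<in> ?M \<rightarrow> S" "\<And>x. x \<in> S \<Longrightarrow> r j x = x" if "j < N" for j
    using r that by (auto simp: dispersing_retractions_def coarse_retraction_def)
  have disp: "j = j' \<and> a = a'"
    if "r j a = r j' a'" "j < N" "j' < N" "a \<in> ?M - S" "a' \<in> ?M - S" for j j' a a'
    using r that unfolding dispersing_retractions_def inj_on_def by force
  have B0: "0 \<le> ?B" using uf_norm_upper[OF c, of "[]"] by linarith
  have tup: "set x \<subseteq> ?M \<and> length x = Suc n" if "c x \<noteq> 0" for x
    using that c by (auto simp: uf_chains_iff uf_tuples_def)
  define bad where "bad = {j. j < N \<and> (\<exists>p\<in>set y. \<exists>a\<in>?M - S. r j a = p)}"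
  have fib: "\<bar>extend_to_sums (map (r j)) c y\<bar> \<le> k * ?B"
    if "card {x. c x \<noteq> 0 \<and> map (r j) x = y} \<le> k" for j k
  proof -
    have "\<bar>extend_to_sums (map (r j)) c y\<bar> \<le> (\<Sum>x | c x \<noteq> 0 \<and> map (r j) x = y. \<bar>c x\<bar>)"
      unfolding extend_to_sums_def by (rule sum_abs)
    also have "\<dots> \<le> real (card {x. c x \<noteq> 0 \<and> map (r j) x = y}) * ?B"
      by (rule sum_bounded_above) (rule uf_norm_upper[OF c])
    also have "\<dots> \<le> k * ?B"
      using that B0 by (intro mult_right_mono) auto
    finally show ?thesis .
  qed
  show "\<bar>\<Sum>j<N. 1 / N * extend_to_sums (map (r j)) c y\<bar> \<le> (1 + Suc n * 2 ^ Suc n / N) * ?B"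
  proof (cases "length y = Suc n")
    case False
    have "extend_to_sums (map (r j)) c y = 0" for j
    proof (rule ccontr)
      assume "extend_to_sums (map (r j)) c y \<noteq> 0"
      then obtain x where "c x \<noteq> 0" "map (r j) x = y" by (rule extend_to_sums_nonzero)
      then show False using tup False by auto
    qed
    then show ?thesis using B0 by simp
  next
    case True
    have good: "\<bar>extend_to_sums (map (r j)) c y\<bar> \<le> ?B" if j: "j < N" "j \<notin> bad" for j
    proof -
      have "x = y" if "c x \<noteq> 0" "map (r j) x = y" for x
      proof -
        have "r j a = a" if a: "a \<in> set x" for a
        proof (rule ret(2)[OF j(1)], rule ccontr)
          assume "a \<notin> S"
          moreover have "a \<in> ?M" using a tup[OF \<open>c x \<noteq> 0\<close>] by blast
          moreover have "r j a \<in> set y" using a \<open>map (r j) x = y\<close> by auto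
          ultimately show False using j unfolding bad_def by blast
        qed
        then show ?thesis using \<open>map (r j) x = y\<close> by (metis map_idI)
      qed
      then have "{x. c x \<noteq> 0 \<and> map (r j) x = y} \<subseteq> {y}" by blast
      then have "card {x. c x \<noteq> 0 \<and> map (r j) x = y} \<le> 1"
        using card_mono[of "{y}"] by simp
      from fib[OF this] show ?thesis by simp
    qed
    have any: "\<bar>extend_to_sums (map (r j)) c y\<bar> \<le> 2 ^ Suc n * ?B" if j: "j < N" for j
    proof -
      have two: "finite {a \<in> ?M. r j a = b} \<and> card {a \<in> ?M. r j a = b} \<le> 2" for b
      proof -
        let ?out = "{a \<in> ?M - S. r j a = b}"
        have uniq: "a = a'" if "a \<in> ?out" "a' \<in> ?out" for a a'
          using disp j that by blast
        have fin: "finite ?out"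
        proof (cases "?out = {}")
          case False
          then obtain a where "a \<in> ?out" by blast
          then have "?out \<subseteq> {a}" using uniq by blast
          then show ?thesis by (rule finite_subset) simp
        next
          case True
          then show ?thesis by (simp only: finite.emptyI)
        qed
        have one: "card {a \<in> ?M - S. r j a = b} \<le> 1"
          using uniq card_le_Suc0_iff_eq[OF fin] by auto
        have sub: "{a \<in> ?M. r j a = b} \<subseteq> insert b {a \<in> ?M - S. r j a = b}"
          using ret(2)[OF j] by auto
        have "card {a \<in> ?M. r j a = b} \<le> card (insert b {a \<in> ?M - S. r j a = b})"
          using fin by (intro card_mono sub) simp
        also have "\<dots> \<le> Suc (card {a \<in> ?M - S. r j a = b})"
          by (rule card_insert_le_m1) auto
        finally show ?thesis using one finite_subset[OF sub] fin by simp
      qed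
      have "{x. c x \<noteq> 0 \<and> map (r j) x = y} \<subseteq> {x. set x \<subseteq> ?M \<and> map (r j) x = y}"
        using tup by blast
      then have "card {x. c x \<noteq> 0 \<and> map (r j) x = y} \<le> 2 ^ Suc n"
        using card_map_fibre[of ?M "r j" 2 y, OF two] card_mono[of "{x. set x \<subseteq> ?M \<and> map (r j) x = y}"]
        unfolding True by (meson order_trans)
      from fib[OF this] show ?thesis by simp
    qed
    have "card bad \<le> Suc n"
    proof -
      let ?b = "\<lambda>p. {j. j < N \<and> (\<exists>a\<in>?M - S. r j a = p)}"
      have "card (?b p) \<le> 1" for p
      proof -
        have fin: "finite (?b p)" by simp
        have "i = j" if ij: "i \<in> ?b p" "j \<in> ?b p" for i j
        proof -
          obtain a a' where "r i a = p" "r j a' = p" "a \<in> ?M - S" "a' \<in> ?M - S"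
            using ij by blast
          then show ?thesis using disp[of i a j a'] ij by simp
        qed
        then show ?thesis using card_le_Suc0_iff_eq[OF fin] by simp
      qed
      then have "(\<Sum>p\<in>set y. card (?b p)) \<le> card (set y)"
        using sum_bounded_above[of "set y" "\<lambda>p. card (?b p)" 1] by simp
      moreover have "bad = (\<Union>p\<in>set y. ?b p)" unfolding bad_def by blast
      ultimately show ?thesis
        using card_UN_le[of "set y" ?b] card_length[of y] True by simp
    qed
    have "\<bar>\<Sum>j<N. 1 / N * extend_to_sums (map (r j)) c y\<bar> \<le> (\<Sum>j<N. 1 / N * \<bar>extend_to_sums (map (r j)) c y\<bar>)"
      by (rule order_trans[OF sum_abs]) (simp add: abs_mult)
    also have "\<dots> \<le> (\<Sum>j<N. 1 / N * (?B + (if j \<in> bad then 2 ^ Suc n * ?B else 0)))"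
    proof (intro sum_mono mult_left_mono)
      fix j assume "j \<in> {..<N}"
      then show "\<bar>extend_to_sums (map (r j)) c y\<bar> \<le> ?B + (if j \<in> bad then 2 ^ Suc n * ?B else 0)"
        using good any[of j] B0 by auto
    qed simp
    also have "\<dots> = 1 / N * (N * ?B + card bad * (2 ^ Suc n * ?B))"
    proof -
      have "{..<N} \<inter> bad = bad" unfolding bad_def by auto
      then have "(\<Sum>j<N. if j \<in> bad then 2 ^ Suc n * ?B else 0) = card bad * (2 ^ Suc n * ?B)"
        using sum.inter_restrict[of "{..<N}" "\<lambda>_. 2 ^ Suc n * ?B" bad] by simp
      then show ?thesis unfolding sum_distrib_left[symmetric] sum.distrib by simp
    qed
    also have "\<dots> \<le> 1 / N * (N * ?B + Suc n * (2 ^ Suc n * ?B))"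
      using \<open>card bad \<le> Suc n\<close> B0 by (intro mult_left_mono add_left_mono mult_right_mono) auto
    also have "\<dots> = (1 + Suc n * 2 ^ Suc n / N) * ?B"
      using N by (simp add: field_simps)
    finally show ?thesis .
  qed
qed

lemma uf_seminorm_bdd_below:
  "bdd_below {uf_norm c | c. c \<in> uf_chains n X \<and> uf_boundary n c = (\<lambda>_. 0) \<and> uf_class n X c = \<alpha>}"
proof -
  have "0 \<le> uf_norm c" if "c \<in> uf_chains n X" for c
    using uf_norm_upper[OF that, of "[]"] by linarith
  then show ?thesis by (intro bdd_belowI[of _ 0]) auto
qed

text \<open>Given a cycle \<open>c\<close> of \<open>X\<close>, the averages of its push-forwards are cycles of \<open>S\<close> homologous to \<open>c\<close> in \<open>X\<close>,
  and their norms exceed that of \<open>c\<close> by an amount that tends to zero. By injectivity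
  in homology they represent the given class of \<open>S\<close>.\<close>

lemma inclusion_isometric:
  assumes X: "UDBG X" and S: "S \<subseteq> mspace X"
    and dispersing: "\<And>N. N > 0 \<Longrightarrow> \<exists>r. dispersing_retractions X S N r"
  shows "uf_isometric_isomorphism n (submetric X S) X (uf_induced n X (\<lambda>x. x))"
proof -
  let ?Y = "submetric X S"
  note Y = UDBG_submetric[OF X, of S]
  obtain r where r: "coarse_retraction X S r"
    using dispersing[of 1] by (auto simp: dispersing_retractions_def)
  have "uf_seminorm n X (uf_induced n X (\<lambda>x. x) \<alpha>) = uf_seminorm n ?Y \<alpha>"
    if \<alpha>: "\<alpha> \<in> carrier (uf_homology n ?Y)" for \<alpha>
  proof -
    obtain a where a: "a \<in> uf_cycles n ?Y" "\<alpha> = uf_class n ?Y a"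
      using \<alpha> by (rule uf_homology_carrierE)
    have aX: "a \<in> uf_cycles n X" using a(1) by (simp add: uf_cycles_submetric)
    have F: "uf_induced n X (\<lambda>x. x) \<alpha> = uf_class n X a"
      unfolding a(2) by (rule uf_induced_inclusion[OF X a(1)])
    let ?R = "\<lambda>X \<alpha>. {uf_norm c | c. c \<in> uf_chains n X \<and> uf_boundary n c = (\<lambda>_. 0) \<and> uf_class n X c = \<alpha>}"
    have ne: "uf_norm a \<in> ?R ?Y \<alpha>" "uf_norm a \<in> ?R X (uf_class n X a)"
      using a aX by (auto simp: uf_cycles_def)
    have "?R ?Y \<alpha> \<subseteq> ?R X (uf_class n X a)"
    proof
      fix v assume "v \<in> ?R ?Y \<alpha>"
      then obtain c where v: "v = uf_norm c"
        and c: "c \<in> uf_chains n ?Y" "uf_boundary n c = (\<lambda>_. 0)" "uf_class n ?Y c = \<alpha>"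
        by blast
      then have cyc: "c \<in> uf_cycles n ?Y" by (simp add: uf_cycles_def)
      have "uf_class n X c = uf_class n X a"
        using c(3) uf_class_submetric_eq_iff[OF X S r cyc a(1)] unfolding a(2) by simp
      then show "v \<in> ?R X (uf_class n X a)"
        using c v by (auto simp: uf_chains_submetric)
    qed
    then have le: "uf_seminorm n X (uf_class n X a) \<le> uf_seminorm n ?Y \<alpha>"
      unfolding uf_seminorm_def using ne(1) by (intro cInf_superset_mono uf_seminorm_bdd_below) auto
    have "uf_seminorm n ?Y \<alpha> \<le> uf_norm c" if c: "c \<in> uf_cycles n X" "uf_class n X c = uf_class n X a" for c
    proof (rule field_le_epsilon)
      fix e :: real assume e: "e > 0"
      \<comment> \<open>The excess of the norm of an average over \<open>N\<close> retractions is at most \<open>K / N\<close>.\<close>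
      define K where "K = real (Suc n) * 2 ^ Suc n * uf_norm c"
      obtain m :: nat where "K < real m * e" using ex_less_of_nat_mult[OF e] by blast
      then have "K < real (Suc m) * e" using e by (simp add: algebra_simps)
      moreover define N where "N = Suc m"
      ultimately have N: "N > 0" "K / N \<le> e" by (simp_all add: field_simps)
      obtain r where r': "dispersing_retractions X S N r" using dispersing[OF N(1)] by blast
      then have ret: "coarse_retraction X S (r j)" if "j \<in> {..<N}" for j
        using that by (simp add: dispersing_retractions_def)
      let ?c = "\<lambda>y. \<Sum>j<N. 1 / N * extend_to_sums (map (r j)) c y"
      have cyc: "?c \<in> uf_cycles n ?Y"
        by (intro uf_cycles_sum[OF Y] retraction_cycle[OF X S ret c(1)]) auto
      have "(\<lambda>y. extend_to_sums (map (r j)) c y - c y) \<in> uf_boundaries n X" if j: "j \<in> {..<N}" for j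
      proof -
        obtain D where D: "r j \<in> mspace X \<rightarrow> mspace X" "\<And>x. x \<in> mspace X \<Longrightarrow> mdist X (r j x) x \<le> D"
          by (rule coarse_retraction_bounded[OF S ret[OF j]]) blast
        show ?thesis
          using X D c(1) by (rule prism_homotopy)
      qed
      from uf_boundaries_sum[OF X finite_lessThan this, where w = "\<lambda>_. 1 / real N"]
      have "(\<lambda>y. \<Sum>j<N. 1 / N * (extend_to_sums (map (r j)) c y - c y)) \<in> uf_boundaries n X"
        by simp
      also have "(\<lambda>y. \<Sum>j<N. 1 / N * (extend_to_sums (map (r j)) c y - c y)) = (\<lambda>y. ?c y - c y)"
        using N(1) by (simp add: right_diff_distrib sum_subtractf)
      finally have "uf_class n X ?c = uf_class n X c"
        using uf_class_eq_iff[OF X _ c(1), of ?c] cyc by (simp add: uf_cycles_submetric)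
      then have "uf_class n ?Y ?c = \<alpha>"
        using c(2) uf_class_submetric_eq_iff[OF X S r cyc a(1)] unfolding a(2) by simp
      then have "uf_norm ?c \<in> ?R ?Y \<alpha>"
        using cyc by (auto simp: uf_cycles_def)
      then have "uf_seminorm n ?Y \<alpha> \<le> uf_norm ?c"
        unfolding uf_seminorm_def by (rule cInf_lower[OF _ uf_seminorm_bdd_below])
      also have "\<dots> \<le> (1 + Suc n * 2 ^ Suc n / N) * uf_norm c"
        using c(1) by (intro uf_norm_average[OF r' N(1)]) (simp add: uf_cycles_def)
      also have "\<dots> = uf_norm c + K / N"
        unfolding K_def by (simp add: algebra_simps)
      finally show "uf_seminorm n ?Y \<alpha> \<le> uf_norm c + e" using N(2) by linarith
    qed
    then have "uf_seminorm n ?Y \<alpha> \<le> uf_seminorm n X (uf_class n X a)"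
      unfolding uf_seminorm_def[of n X] using ne(2) by (intro cInf_greatest) (auto simp: uf_cycles_def)
    then show ?thesis using le F by simp
  qed
  then show ?thesis
    unfolding uf_isometric_isomorphism_def using inclusion_linear_isomorphism[OF X S r] by blast
qed

lemma inclusion_quasi_isometry:
  assumes S: "S \<subseteq> mspace X" and r: "coarse_retraction X S r"
  shows "quasi_isometry (submetric X S) X (\<lambda>x. x)"
proof -
  obtain D where D: "r \<in> mspace X \<rightarrow> mspace X" "\<And>x. x \<in> mspace X \<Longrightarrow> mdist X (r x) x \<le> D"
    by (rule coarse_retraction_bounded[OF S r]) blast
  have rS: "r x \<in> S" "r x \<in> mspace X" if "x \<in> mspace X" for x
    using r that S by (auto simp: coarse_retraction_def)
  have near: "mdist X x x' - (2 * \<bar>D\<bar> + 1) \<le> mdist X (r x) (r x')"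
      "mdist X (r x) (r x') \<le> mdist X x x' + (2 * \<bar>D\<bar> + 1)"
    if x: "x \<in> mspace X" "x' \<in> mspace X" for x x'
  proof -
    have "mdist X x x' \<le> mdist X x (r x) + mdist X (r x) x'"
      "mdist X (r x) x' \<le> mdist X (r x) (r x') + mdist X (r x') x'"
      "mdist X (r x) (r x') \<le> mdist X (r x) x + mdist X x (r x')"
      "mdist X x (r x') \<le> mdist X x x' + mdist X x' (r x')"
      using x rS by (simp_all add: mdist_triangle)
    moreover have "mdist X (r z) z \<le> \<bar>D\<bar>" "mdist X z (r z) \<le> \<bar>D\<bar>" if "z \<in> mspace X" for z
      using D(2)[OF that] mdist_commute[of X z "r z"] by linarith+
    note this[OF x(1)] this[OF x(2)]
    ultimately show "mdist X x x' - (2 * \<bar>D\<bar> + 1) \<le> mdist X (r x) (r x')"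
      "mdist X (r x) (r x') \<le> mdist X x x' + (2 * \<bar>D\<bar> + 1)"
      by linarith+
  qed
  have "quasi_isometric_embedding (submetric X S) X (\<lambda>x. x)"
    unfolding quasi_isometric_embedding_def by (intro conjI exI[of _ "1 :: real"]) auto
  moreover have "quasi_isometric_embedding X (submetric X S) r"
    unfolding quasi_isometric_embedding_def using near rS
    by (intro conjI exI[of _ "1 :: real"] exI[of _ "2 * \<bar>D\<bar> + 1"]) auto
  moreover have "uniformly_close X X ((\<lambda>x. x) \<circ> r) id"
    unfolding uniformly_close_def using D(2) by (intro bdd_aboveI[of _ D]) auto
  moreover have "uniformly_close (submetric X S) (submetric X S) (r \<circ> (\<lambda>x. x)) id"
    unfolding uniformly_close_def using r
    by (intro bdd_aboveI[of _ 0]) (auto simp: coarse_retraction_def mdist_self)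
  ultimately show ?thesis unfolding quasi_isometry_def by blast
qed

section \<open>The complement of the squares\<close>

definition squares :: "int set" where
  "squares = {(int n)\<^sup>2 | n. True}"

text \<open>The gap behind \<open>m\<^sup>2\<close> has length \<open>2 m + 1\<close>, and \<open>N\<^sup>2 \<le> m\<^sup>2\<close> forces \<open>m \<ge> N\<close>.\<close>

lemma squares_gap:
  assumes "a \<in> squares" "b \<in> squares" "a < b" and N: "(int N)\<^sup>2 \<le> a"
  shows "a + int N < b"
proof -
  obtain m k where m: "a = (int m)\<^sup>2" and k: "b = (int k)\<^sup>2"
    using assms by (auto simp: squares_def)
  have "N \<le> m" using N unfolding m by (simp add: power2_le_iff_abs_le)
  have "m < k" using \<open>a < b\<close> unfolding m k by (metis not_le of_nat_le_iff of_nat_0_le_iff power_mono)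
  then have "(int m + 1)\<^sup>2 \<le> (int k)\<^sup>2" by (intro power_mono) auto
  then have "a + 2 * int m + 1 \<le> b" unfolding m k by (simp add: power2_sum)
  then show ?thesis using \<open>N \<le> m\<close> by simp
qed

text \<open>The gap behind a square below \<open>N\<^sup>2\<close> may be too short for \<open>N\<close> different targets. There are only finitely
  many such squares, so they can go anywhere without making the displacement unbounded; negative numbers
  are never squares, and \<open>a * N + j\<close> determines \<open>a\<close> and \<open>j\<close> as quotient and remainder.\<close>

definition square_shift :: "nat \<Rightarrow> nat \<Rightarrow> int \<Rightarrow> int" where
  "square_shift N j a =
     (if a \<notin> squares then a
      else if (int N)\<^sup>2 \<le> a then a + int j + 1
      else - (a * int N + int j + 1))"

lemma squares_nonneg: "a \<in> squares \<Longrightarrow> 0 \<le> a"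
  by (auto simp: squares_def)

lemma square_shift_coarse_retraction:
  assumes j: "j < N"
  shows "coarse_retraction int_metric (- squares) (square_shift N j)"
  unfolding coarse_retraction_def
proof (intro conjI ballI exI)
  show "square_shift N j \<in> mspace int_metric \<rightarrow> - squares"
  proof (intro Pi_I ComplI)
    fix a assume sq: "square_shift N j a \<in> squares"
    then have a: "a \<in> squares" unfolding square_shift_def by (auto split: if_splits)
    show False
    proof (cases "(int N)\<^sup>2 \<le> a")
      case True
      then have "a + int N < a + int j + 1"
        using a sq by (intro squares_gap) (auto simp: square_shift_def)
      then show False using j by simp
    next
      case False
      then have "0 \<le> - (a * int N + int j + 1)"
        using a squares_nonneg[OF sq] by (simp add: square_shift_def)
      moreover have "0 \<le> a * int N" using squares_nonneg[OF a] by simp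
      ultimately show False by linarith
    qed
  qed
next
  fix a assume "a \<in> - squares"
  then show "square_shift N j a = a" by (simp add: square_shift_def)
next
  fix a :: int
  show "mdist int_metric (square_shift N j a) a \<le> of_int ((int N)\<^sup>2 * (int N + 1) + int N)"
  proof -
    have "\<bar>square_shift N j a - a\<bar> \<le> (int N)\<^sup>2 * (int N + 1) + int N"
    proof (cases "a \<in> squares \<and> a < (int N)\<^sup>2")
      case True
      then have "0 \<le> a" "a * (int N + 1) \<le> (int N)\<^sup>2 * (int N + 1)"
        using squares_nonneg by (auto intro: mult_right_mono)
      moreover have "- (a * int N + int j + 1) - a = - (a * (int N + 1) + int j + 1)"
        by (simp add: algebra_simps)
      moreover have "0 \<le> a * (int N + 1)" using \<open>0 \<le> a\<close> by simp
      ultimately have "\<bar>- (a * int N + int j + 1) - a\<bar> \<le> (int N)\<^sup>2 * (int N + 1) + int N"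
        using j by linarith
      then show ?thesis using True by (simp add: square_shift_def)
    next
      case False
      have "0 \<le> (int N)\<^sup>2 * (int N + 1)" by simp
      moreover have "\<bar>square_shift N j a - a\<bar> \<le> int N"
        using False j by (auto simp: square_shift_def)
      ultimately show ?thesis by linarith
    qed
    then show ?thesis by (simp del: of_int_add of_int_mult of_int_power)
  qed
qed

lemma square_shift_dispersing: "dispersing_retractions int_metric (- squares) N (square_shift N)"
  unfolding dispersing_retractions_def
proof (intro conjI allI impI inj_onI)
  show "coarse_retraction int_metric (- squares) (square_shift N j)" if "j < N" for j
    using that by (rule square_shift_coarse_retraction)
next
  fix p q assume "p \<in> {..<N} \<times> (mspace int_metric - - squares)" "q \<in> {..<N} \<times> (mspace int_metric - - squares)"
    and "(case p of (j, a) \<Rightarrow> square_shift N j a) = (case q of (j, a) \<Rightarrow> square_shift N j a)"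
  then obtain j a k b where p: "p = (j, a)" and q: "q = (k, b)" and jk: "j < N" "k < N"
    and ab: "a \<in> squares" "b \<in> squares" and eq: "square_shift N j a = square_shift N k b"
    by (cases p; cases q) auto
  have pos: "0 \<le> a" "0 \<le> b" "0 \<le> a * int N" "0 \<le> b * int N" using ab squares_nonneg by simp_all
  have "a = b \<and> j = k"
  proof (cases "(int N)\<^sup>2 \<le> a"; cases "(int N)\<^sup>2 \<le> b")
    assume big: "(int N)\<^sup>2 \<le> a" "(int N)\<^sup>2 \<le> b"
    then have "a + int j = b + int k" using eq ab by (simp add: square_shift_def)
    moreover have "\<not> a < b" "\<not> b < a"
      using squares_gap[OF ab _ big(1)] squares_gap[OF ab(2,1) _ big(2)] jk \<open>a + int j = b + int k\<close>
      by linarith+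
    ultimately show ?thesis by simp
  next
    assume "\<not> (int N)\<^sup>2 \<le> a" "\<not> (int N)\<^sup>2 \<le> b"
    then have eq': "a * int N + int j = b * int N + int k" using eq ab by (simp add: square_shift_def)
    have "(a * int N + int j) div int N = a" "(b * int N + int k) div int N = b"
      using jk by (simp_all add: div_add1_eq)
    then show ?thesis using eq' by simp
  qed (use eq ab pos in \<open>auto simp: square_shift_def\<close>)
  then show "p = q" unfolding p q by simp
qed

text \<open>Preimages of \<open>{1..L}\<close> are non-squares in \<open>{1 - D..L + D}\<close>. With \<open>L = (2 D + 1)\<^sup>2\<close>
  this interval of \<open>L + 2 D\<close> integers contains the squares of \<open>1, \<dots>, 2 D + 1\<close>, so fewer than \<open>L\<close>
  integers are left.\<close>

lemma no_close_surjection: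
  fixes g :: "int \<Rightarrow> int" and D :: nat
  assumes near: "\<And>x. x \<in> - squares \<Longrightarrow> \<bar>x - g x\<bar> \<le> int D"
  shows "g ` (- squares) \<noteq> UNIV"
proof
  assume surj: "g ` (- squares) = UNIV"
  define L where "L = (2 * int D + 1)\<^sup>2"
  define Q where "Q = (\<lambda>m. (int m)\<^sup>2) ` {1..2 * D + 1}"
  have "inj_on (\<lambda>m. (int m)\<^sup>2) {1..2 * D + 1}"
    by (auto simp: inj_on_def)
  then have cardQ: "card Q = 2 * D + 1" unfolding Q_def by (simp add: card_image)
  have Qsub: "Q \<subseteq> {1 - int D..L + int D}"
  proof
    fix b assume "b \<in> Q"
    then obtain m where m: "b = (int m)\<^sup>2" "1 \<le> m" "m \<le> 2 * D + 1" unfolding Q_def by auto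
    have "int m \<le> 2 * int D + 1" using m(3) by simp
    then have "(int m)\<^sup>2 \<le> L" unfolding L_def by (intro power_mono) auto
    moreover have "1 \<le> (int m)\<^sup>2" using m(2) by (simp add: one_le_power)
    ultimately show "b \<in> {1 - int D..L + int D}" unfolding m(1) by simp
  qed
  have "Q \<subseteq> squares" unfolding Q_def squares_def by auto
  have "{1..L} \<subseteq> g ` ({1 - int D..L + int D} - Q)"
  proof
    fix y assume y: "y \<in> {1..L}"
    obtain x where x: "x \<in> - squares" "y = g x" using surj by (metis UNIV_I imageE)
    then show "y \<in> g ` ({1 - int D..L + int D} - Q)"
      using near[OF x(1)] y \<open>Q \<subseteq> squares\<close> by (intro image_eqI[of _ _ x]) auto
  qed
  then have "card {1..L} \<le> card ({1 - int D..L + int D} - Q)"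
    by (intro surj_card_le) auto
  also have "\<dots> = card {1 - int D..L + int D} - card Q"
    using Qsub by (intro card_Diff_subset finite_subset[OF Qsub]) auto
  finally have "nat L \<le> nat (L + 2 * int D) - (2 * D + 1)"
    unfolding cardQ by (simp add: algebra_simps)
  moreover have "0 < L" unfolding L_def by simp
  ultimately show False by linarith
qed

theorem proposition3p5:
  fixes A :: "int set" and Z :: "int metric" and ZA :: "int metric" and i :: "int \<Rightarrow> int"
  assumes "A = {(int n)\<^sup>2 | n. True}"
    and "Z = int_metric"
    and "ZA = submetric Z (mspace Z - A)"
    and "i = (\<lambda>x. x)"
  shows "quasi_isometry ZA Z i \<and>
    (\<forall>k::nat. uf_isometric_isomorphism k ZA Z (uf_induced k Z i)) \<and>
    \<not> (\<exists>g. bilipschitz_equivalence ZA Z g \<and> uniformly_close ZA Z i g)"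
proof -
  have ZA: "ZA = submetric int_metric (- squares)" "mspace ZA = - squares"
    using assms by (simp_all add: squares_def Compl_eq_Diff_UNIV)
  have sub: "- squares \<subseteq> mspace int_metric" by simp
  have "quasi_isometry ZA Z i"
    unfolding ZA assms(2,4)
    \<comment> \<open>For the quasi-isometry any one of the retractions will do.\<close>
    by (rule inclusion_quasi_isometry[OF sub square_shift_coarse_retraction[of 0 1]]) simp
  moreover have "uf_isometric_isomorphism k ZA Z (uf_induced k Z i)" for k
    unfolding ZA assms(2,4)
    by (rule inclusion_isometric[OF UDBG_int_metric sub]) (blast intro: square_shift_dispersing)
  moreover have False if g: "bilipschitz_equivalence ZA Z g" and close: "uniformly_close ZA Z i g" for g
  proof -
    obtain B where B: "\<And>x. x \<in> - squares \<Longrightarrow> of_int \<bar>x - g x\<bar> \<le> (B :: real)"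
      using close unfolding uniformly_close_def ZA(2) assms(2,4) by (auto simp: bdd_above_def)
    have "\<bar>x - g x\<bar> \<le> int (nat \<lceil>B\<rceil>)" if "x \<in> - squares" for x
      using B[OF that] by linarith
    then have "g ` (- squares) \<noteq> UNIV" by (rule no_close_surjection)
    moreover obtain h where "h \<in> mspace Z \<rightarrow> mspace ZA" "\<forall>y\<in>mspace Z. g (h y) = y"
      using g unfolding bilipschitz_equivalence_def bilipschitz_embedding_def by blast
    then have "y \<in> g ` (- squares)" for y
      using ZA(2) assms(2) by (intro image_eqI[of _ _ "h y"]) auto
    ultimately show False by blast
  qed
  ultimately show ?thesis by blast
qed

end
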